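(* Let an HiMM $Z$ be given and consider the Optimal Exit Computer with only one modification $m_{\mathrm{seq}}=m$. Assume that all optimal exit costs of $Z$ are computed before the modification (i.e. $Z$ has no marked MMs and the optimal exit costs of all its MMs are stored), and that the same holds for $Z_{\mathrm{add}}$ if $m$ is a state addition, or for $Z_1,\dots,Z_n$ if $m$ is a composition. Let $b_s$ be the maximum number of states in an MM of $Z$. Then the time complexity of executing the Optimal Exit Computer (marking, followed by $\mathrm{Compute\_optimal\_exits}$) is $$O\big(\mathrm{depth}(Z)\,[\,b_s|\Sigma|+(b_s+|\Sigma|)\log(b_s+|\Sigma|)\,]\big)$$ if $m$ is a state addition, state subtraction, or arc modification, and $$O\big(b_s|\Sigma|+(b_s+|\Sigma|)\log(b_s+|\Sigma|)\big)$$ if $m$ is a composition. In particular, assuming a bound on the number of states and inputs of the MMs in $Z$, the time complexity for any modification is $O(\mathrm{depth}(Z))$ (and in this sense the planning algorithm using the Optimal Exit Computer is reconfigurable).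
   Context: **Mealy machines.** $f:A\rightharpoonup B$ denotes a partial function, and $f(a)=\emptyset$ means that $f$ is undefined at $a$. $\mathbb{R}^+=\{x\in\mathbb{R}:x\ge 0\}$. A Mealy machine (MM) is a tuple $M=(Q,\Sigma,\Lambda,\delta,\gamma,s)$ with finite state set $Q=Q(M)$, finite input set $\Sigma$, finite output set $\Lambda$, transition function $\delta=\delta_M:Q\times\Sigma\rightharpoonup Q$, output function $\gamma=\gamma_M:Q\times\Sigma\to\Lambda$, and start state $s=s(M)\in Q$. Throughout $\Lambda\subset\mathbb{R}^+$ (outputs are costs). **HiMMs.** A hierarchical Mealy machine (HiMM) is a pair $Z=(X,T)$, where $X$ is a finite set of MMs with common input set $\Sigma$ and common output set $\Lambda$ and pairwise disjoint state sets, and $T$ is a rooted tree with node set $X$ in which each $M\in X$ has exactly $|Q(M)|$ outgoing arcs $M\xrightarrow{q}N_q$, $q\in Q(M)$, where either $N_q\in X$ (state $q$ is refined by the MM $N_q$) or $N_q=\emptyset$ (terminal arc). Put $Q_Z=\bigcup_{M\in X}Q(M)$ and $S_Z=\{q\in Q_Z:N_q=\emptyset\}$ (the states of $Z$). $\mathrm{depth}(Z)$ is the number of layers of $Z$, i.e. the maximum number of arcs (terminal arcs included) one can traverse in $T$ starting from the root. - Start function $\mathrm{start}:X\to S_Z$: $\mathrm{start}(M)=\mathrm{start}(N)$ if $(M\xrightarrow{s(M)}N)\in T$ with $N\in X$, and $\mathrm{start}(M)=s(M)$ otherwise. - Hierarchical transition function $\psi:Q_Z\times\Sigma\rightharpoonup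 S_Z$: for $q\in Q(M)$ and $v=\delta_M(q,x)$, $\psi(q,x)=\mathrm{start}(Y)$ if $v\neq\emptyset$ and $(M\xrightarrow{v}Y)\in T$ with $Y\in X$; $\psi(q,x)=v$ if $v\ne\emptyset$ otherwise; $\psi(q,x)=\psi(w,x)$ if $v=\emptyset$ and $(W\xrightarrow{w}M)\in T$ with $W\in X$; $\psi(q,x)=\emptyset$ if $v=\emptyset$ and $M$ is the root. - Hierarchical output function $\chi:Q_Z\times\Sigma\rightharpoonup\Lambda$: with the same $v$, $\chi(q,x)=\gamma_M(q,x)$ if $v\neq\emptyset$; $\chi(q,x)=\chi(w,x)$ if $v=\emptyset$ and $(W\xrightarrow{w}M)\in T$ with $W\in X$; $\chi(q,x)=\emptyset$ otherwise. A trajectory of $Z$ is a finite sequence $(q_i,x_i)_{i=1}^N\in(S_Z\times\Sigma)^N$ with $q_{i+1}=\psi(q_i,x_i)$ for $1\le i\le N-1$. **Optimal exit costs.** A state $q\in S_Z$ is contained in $M\in X$ if it is a descendant of $M$ in $T$ (i.e. $q$ is a state of $M$ or of an MM that is a descendant of $M$). For $q$ contained in $M$, the pair $(q,x)$ exits $M$ if the transition happens outside the subtree rooted at $M$, i.e. if in the recursive evaluation of $\psi(q,x)$ all MMs on the path from the MM having $q$ as a state up to and including $M$ have undefined transition. An $(M,x)$-exit trajectory is a trajectory $(q_i,x_i)_{i=1}^N$ with $q_1=\mathrm{start}(M)$, all $q_i$ contained in $M$, $x_N=x$, $(q_N,x_N)$ exiting $M$, and $(q_i,x_i)$ not exiting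 $M$ for $i<N$. Its $(M,x)$-exit cost is $\sum_{i=1}^{N-1}\chi(q_i,x_i)$. The optimal exit cost $c^M_x$ is the minimum of all $(M,x)$-exit costs ($+\infty$ if there is no such trajectory). **Modifications.** - State addition: given an HiMM $Z$, an MM $M$ of $Z$, and an HiMM $Z_{\mathrm{add}}$, add a new state $q\notin Q(M)$ to $M$ and an arc $M\xrightarrow{q}N$ to the root MM $N$ of the tree of $Z_{\mathrm{add}}$; alternatively (adding just a state) add a terminal arc $M\xrightarrow{q}\emptyset$. No transitions to or from $q$ are added. - State subtraction: remove a state $q\in Q(M)$, $q\neq s(M)$, from an MM $M$ of $Z$ (with transitions to or from it) together with the $q$-arc from $M$ (and the subtree below it). - Arc modification: replace an MM $M=(Q,\Sigma,\Lambda,\delta,\gamma,s)$ of $Z$ by $(Q,\Sigma,\Lambda,\delta',\gamma',s')$ with arbitrary new $\delta',\gamma',s'$. - Composition: given an MM $M$ with states $q_1,\dots,q_{|Q|}$ and HiMMs $Z_1,\dots,Z_n$, $n\le|Q|$, form the HiMM whose tree has root $M$ and arcs $M\xrightarrow{q_i}R_i$ for $i\le n$ with $R_i$ the root MM of $Z_i$, and $M\xrightarrow{q_i}\emptyset$ for $i>n$. The algorithms below act on the modified HiMM, and $\mathrm{depth}(Z)$ and $b_s$ in the bounds refer to this HiMM (for a composition, $Z$ is the resulting HiMM). **Marking.** Each MM of an HiMM is either marked or unmarked, and may carry stored values $(c^M_x,z^M_x)_{x\in\Sigma}$. The procedure $\mathrm{Mark}$, run right after a modification concerning the MM $M$, marks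 $M$ and, if the modification is not a composition, also all ancestors of $M$ in the tree of the modified HiMM. HiMMs used in a state addition or composition keep their marks and stored values. **Algorithm $\mathrm{Compute\_optimal\_exits}(Z)$.** Run $\mathrm{Optimal\_exit}(M_0)$ for the root MM $M_0$, where $\mathrm{Optimal\_exit}(M)$ is defined recursively: if $M$ is not marked, return the stored $(c^M_x,z^M_x)_{x\in\Sigma}$. Otherwise, for each $q\in Q(M)$ set $c^q_x=0$ for all $x\in\Sigma$ if $q\in S_Z$, and otherwise set $(c^q_x,z^q_x)_{x\in\Sigma}$ to the result of $\mathrm{Optimal\_exit}(N_q)$. Then construct the augmented MM $\hat M$ with states $Q(M)\cup\{E_x\}_{x\in\Sigma}$, start state $s(M)$, and, for $q\in Q(M)$, $y\in\Sigma$: $\hat\delta(q,y)=\delta_M(q,y)$ and $\hat\gamma(q,y)=c^q_y+\gamma_M(q,y)$ if $\delta_M(q,y)\neq\emptyset$; $\hat\delta(q,y)=E_y$ and $\hat\gamma(q,y)=c^q_y$ otherwise (values at the states $E_x$ are immaterial). Run Dijkstra's algorithm in $\hat M$ from $s(M)$ and let $c^M_x$ be the minimal cumulative cost of reaching $E_x$ ($+\infty$ if unreachable) and $z^M_x$ a corresponding optimal trajectory. Store these values, unmark $M$, and return $(c^M_x,z^M_x)_{x\in\Sigma}$. **Optimal Exit Computer and cost model.** For a single modification $m$, the Optimal Exit Computer consists of running $\mathrm{Mark}$ for $m$ and then $\mathrm{Compute\_optimal\_exits}$ on the modified HiMM; carrying out the modification itself is done by the system and is not counted. Time is counted in elementary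 operations (arithmetic and comparison of costs have unit cost), with Dijkstra's algorithm implemented with Fibonacci heaps, i.e. running in time $O(E+V\log V)$ on a graph with $V$ vertices and $E$ arcs. A planning algorithm is called reconfigurable if a change of the HiMM given by any of the four modifications can be handled with low time complexity. *)

theory Defs
  imports Complex_Main "HOL-Library.Extended_Nonnegative_Real"
begin

section \<open>Mealy machines\<close>

text \<open>
  The type of costs is a parameter, since the augmented machines built by the algorithm have
  extended costs. The fields \<open>delta\<close> and \<open>gamma\<close> are only
  meaningful on \<open>states \<times> inputs\<close>.
\<close>

record ('q, 'x, 'c) mm =
  states :: "'q set"
  inputs :: "'x set"
  outputs :: "'c set"
  delta :: "'q \<Rightarrow> 'x \<Rightarrow> 'q option"
  gamma :: "'q \<Rightarrow> 'x \<Rightarrow> 'c"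
  start :: 'q

definition is_mm :: "('q, 'x, 'c) mm \<Rightarrow> bool" where
  "is_mm A \<longleftrightarrow>
     finite (states A) \<and> finite (inputs A) \<and> finite (outputs A) \<and>
     (\<forall>q\<in>states A. \<forall>x\<in>inputs A. \<forall>v. delta A q x = Some v \<longrightarrow> v \<in> states A) \<and>
     (\<forall>q\<in>states A. \<forall>x\<in>inputs A. gamma A q x \<in> outputs A) \<and>
     start A \<in> states A"


section \<open>Hierarchical Mealy machines\<close>

text \<open>
  The machines of \<open>X\<close> are named by the elements of a finite set \<open>nodes\<close>. Their state
  sets are nonempty and pairwise disjoint, so different nodes carry different machines.
  Since the state sets are disjoint, the arcs of the tree are determined by
  \<open>child\<close>: the arc of the state \<open>q\<close> leads to \<open>N\<close> if
  \<open>child Z q = Some N\<close>, and it is terminal if \<open>child Z q = None\<close>.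
  Naming the machines allows the marks and the stored values of a machine to survive a change of
  that machine or of the tree.
\<close>

record ('n, 'q, 'x) himm =
  nodes :: "'n set"
  machine :: "'n \<Rightarrow> ('q, 'x, real) mm"
  root_node :: 'n
  child :: "'q \<Rightarrow> 'n option"

definition Sigma_of :: "('n, 'q, 'x) himm \<Rightarrow> 'x set" where
  "Sigma_of Z = inputs (machine Z (root_node Z))"

definition Lambda_of :: "('n, 'q, 'x) himm \<Rightarrow> real set" where
  "Lambda_of Z = outputs (machine Z (root_node Z))"

definition all_states :: "('n, 'q, 'x) himm \<Rightarrow> 'q set" where
  "all_states Z = (\<Union>n\<in>nodes Z. states (machine Z n))"

definition terminal_states :: "('n, 'q, 'x) himm \<Rightarrow> 'q set" where
  "terminal_states Z = {q \<in> all_states Z. child Z q = None}"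

definition tree_arcs :: "('n, 'q, 'x) himm \<Rightarrow> ('n \<times> 'n) set" where
  "tree_arcs Z =
     {(m, n). m \<in> nodes Z \<and> (\<exists>q\<in>states (machine Z m). child Z q = Some n)}"

definition is_rooted_tree :: "('n, 'q, 'x) himm \<Rightarrow> bool" where
  "is_rooted_tree Z \<longleftrightarrow>
     root_node Z \<in> nodes Z \<and>
     (\<forall>q\<in>all_states Z. \<forall>n. child Z q = Some n \<longrightarrow> n \<in> nodes Z) \<and>
     (\<forall>q\<in>all_states Z. child Z q \<noteq> Some (root_node Z)) \<and>
     (\<forall>n\<in>nodes Z - {root_node Z}. \<exists>!q. q \<in> all_states Z \<and> child Z q = Some n) \<and>
     (\<forall>n\<in>nodes Z. (root_node Z, n) \<in> (tree_arcs Z)\<^sup>*)"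

definition is_himm :: "('n, 'q, 'x) himm \<Rightarrow> bool" where
  "is_himm Z \<longleftrightarrow>
     finite (nodes Z) \<and>
     (\<forall>n\<in>nodes Z. is_mm (machine Z n) \<and>
        inputs (machine Z n) = Sigma_of Z \<and> outputs (machine Z n) = Lambda_of Z) \<and>
     Lambda_of Z \<subseteq> {0..} \<and>
     (\<forall>m\<in>nodes Z. \<forall>n\<in>nodes Z. m \<noteq> n \<longrightarrow>
        states (machine Z m) \<inter> states (machine Z n) = {}) \<and>
     is_rooted_tree Z"

fun arc_path :: "('n, 'q, 'x) himm \<Rightarrow> 'n \<Rightarrow> 'q list \<Rightarrow> bool" where
  "arc_path Z n [] = True"
| "arc_path Z n (q # qs) =
     (q \<in> states (machine Z n) \<and>
      (qs = [] \<or> (\<exists>n'. child Z q = Some n' \<and> arc_path Z n' qs)))"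

definition depth :: "('n, 'q, 'x) himm \<Rightarrow> nat" where
  "depth Z = Max (length ` {qs. arc_path Z (root_node Z) qs})"

definition max_states :: "('n, 'q, 'x) himm \<Rightarrow> nat" where
  "max_states Z = Max ((\<lambda>n. card (states (machine Z n))) ` nodes Z)"

definition node_of :: "('n, 'q, 'x) himm \<Rightarrow> 'q \<Rightarrow> 'n" where
  "node_of Z q = (THE n. n \<in> nodes Z \<and> q \<in> states (machine Z n))"

definition parent_state :: "('n, 'q, 'x) himm \<Rightarrow> 'n \<Rightarrow> 'q option" where
  "parent_state Z n =
     (if \<exists>w\<in>all_states Z. child Z w = Some n
      then Some (THE w. w \<in> all_states Z \<and> child Z w = Some n) else None)"

text \<open>
  On a tree the following recursions terminate, so \<open>None\<close> arises only from the explicit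
  equations. The value of \<open>hstart\<close> is always defined.
\<close>

partial_function (option) hstart :: "('n, 'q, 'x) himm \<Rightarrow> 'n \<Rightarrow> 'q option" where
  "hstart Z n =
     (case child Z (start (machine Z n)) of
        Some n' \<Rightarrow> hstart Z n'
      | None \<Rightarrow> Some (start (machine Z n)))"

partial_function (option) psi :: "('n, 'q, 'x) himm \<Rightarrow> 'q \<Rightarrow> 'x \<Rightarrow> 'q option" where
  "psi Z q x =
     (case delta (machine Z (node_of Z q)) q x of
        Some v \<Rightarrow> (case child Z v of Some n \<Rightarrow> hstart Z n | None \<Rightarrow> Some v)
      | None \<Rightarrow>
          (case parent_state Z (node_of Z q) of Some w \<Rightarrow> psi Z w x | None \<Rightarrow> None))"

partial_function (option) chi :: "('n, 'q, 'x) himm \<Rightarrow> 'q \<Rightarrow> 'x \<Rightarrow> real option" where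
  "chi Z q x =
     (case delta (machine Z (node_of Z q)) q x of
        Some v \<Rightarrow> Some (gamma (machine Z (node_of Z q)) q x)
      | None \<Rightarrow>
          (case parent_state Z (node_of Z q) of Some w \<Rightarrow> chi Z w x | None \<Rightarrow> None))"

definition trajectory :: "('n, 'q, 'x) himm \<Rightarrow> ('q \<times> 'x) list \<Rightarrow> bool" where
  "trajectory Z w \<longleftrightarrow>
     set w \<subseteq> terminal_states Z \<times> Sigma_of Z \<and>
     (\<forall>i. Suc i < length w \<longrightarrow>
        psi Z (fst (w ! i)) (snd (w ! i)) = Some (fst (w ! Suc i)))"


section \<open>Optimal exit costs\<close>

definition contained_in :: "('n, 'q, 'x) himm \<Rightarrow> 'n \<Rightarrow> 'q \<Rightarrow> bool" where
  "contained_in Z m q \<longleftrightarrow>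
     (\<exists>n\<in>nodes Z. (m, n) \<in> (tree_arcs Z)\<^sup>* \<and> q \<in> states (machine Z n))"

inductive exits :: "('n, 'q, 'x) himm \<Rightarrow> 'n \<Rightarrow> 'q \<Rightarrow> 'x \<Rightarrow> bool"
  for Z :: "('n, 'q, 'x) himm" and m :: 'n where
  exits_here:
    "\<lbrakk>m \<in> nodes Z; q \<in> states (machine Z m); delta (machine Z m) q x = None\<rbrakk>
     \<Longrightarrow> exits Z m q x"
| exits_above:
    "\<lbrakk>n \<in> nodes Z; q \<in> states (machine Z n); delta (machine Z n) q x = None;
      w \<in> all_states Z; child Z w = Some n; exits Z m w x\<rbrakk>
     \<Longrightarrow> exits Z m q x"

definition exit_trajectory ::
  "('n, 'q, 'x) himm \<Rightarrow> 'n \<Rightarrow> 'x \<Rightarrow> ('q \<times> 'x) list \<Rightarrow> bool" where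
  "exit_trajectory Z m x w \<longleftrightarrow>
     w \<noteq> [] \<and> trajectory Z w \<and>
     hstart Z m = Some (fst (hd w)) \<and>
     (\<forall>(q, y)\<in>set w. contained_in Z m q) \<and>
     snd (last w) = x \<and> exits Z m (fst (last w)) (snd (last w)) \<and>
     (\<forall>(q, y)\<in>set (butlast w). \<not> exits Z m q y)"

definition exit_cost :: "('n, 'q, 'x) himm \<Rightarrow> ('q \<times> 'x) list \<Rightarrow> ennreal" where
  "exit_cost Z w = (\<Sum>(q, y)\<leftarrow>butlast w. ennreal (the (chi Z q y)))"

text \<open>
  The infimum is a minimum if it is finite, as all costs are sums of elements of a finite set of
  nonnegative reals. It is infinite if there is no exit trajectory.
\<close>

definition opt_exit_cost :: "('n, 'q, 'x) himm \<Rightarrow> 'n \<Rightarrow> 'x \<Rightarrow> ennreal" where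
  "opt_exit_cost Z m x = (INF w\<in>{w. exit_trajectory Z m x w}. exit_cost Z w)"


section \<open>Modifications\<close>

definition same_on ::
  "'n set \<Rightarrow> 'q set \<Rightarrow> ('n, 'q, 'x) himm \<Rightarrow> ('n, 'q, 'x) himm \<Rightarrow> bool" where
  "same_on N Q Y Z \<longleftrightarrow>
     (\<forall>n\<in>N. machine Z n = machine Y n) \<and> (\<forall>q\<in>Q. child Z q = child Y q)"

definition compatible :: "('n, 'q, 'x) himm \<Rightarrow> ('n, 'q, 'x) himm \<Rightarrow> bool" where
  "compatible Y Z \<longleftrightarrow>
     Sigma_of Y = Sigma_of Z \<and> Lambda_of Y = Lambda_of Z \<and>
     nodes Y \<inter> nodes Z = {} \<and> all_states Y \<inter> all_states Z = {}"

text \<open>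
  In the following relations \<open>Z'\<close> is the modified HiMM. The output function is total, so
  adding a state also adds some outputs at that state. They are never used, because the new state
  has no transitions, and they are left unspecified.
\<close>

definition state_addition ::
  "('n, 'q, 'x) himm \<Rightarrow> 'n \<Rightarrow> 'q \<Rightarrow> ('n, 'q, 'x) himm option
   \<Rightarrow> ('n, 'q, 'x) himm \<Rightarrow> bool" where
  "state_addition Z m q Zadd Z' \<longleftrightarrow>
     m \<in> nodes Z \<and> q \<notin> all_states Z \<and>
     root_node Z' = root_node Z \<and> same_on (nodes Z - {m}) (all_states Z) Z Z' \<and>
     (let A = machine Z m; A' = machine Z' m in
        is_mm A' \<and> states A' = insert q (states A) \<and> inputs A' = inputs A \<and>
        outputs A' = outputs A \<and> start A' = start A \<and>
        (\<forall>x\<in>inputs A. delta A' q x = None) \<and>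
        (\<forall>p\<in>states A. \<forall>x\<in>inputs A.
           delta A' p x = delta A p x \<and> gamma A' p x = gamma A p x)) \<and>
     (case Zadd of
        None \<Rightarrow> nodes Z' = nodes Z \<and> child Z' q = None
      | Some Y \<Rightarrow> compatible Y Z \<and> q \<notin> all_states Y \<and>
          nodes Z' = nodes Z \<union> nodes Y \<and> child Z' q = Some (root_node Y) \<and>
          same_on (nodes Y) (all_states Y) Y Z')"

definition state_subtraction ::
  "('n, 'q, 'x) himm \<Rightarrow> 'n \<Rightarrow> 'q \<Rightarrow> ('n, 'q, 'x) himm \<Rightarrow> bool" where
  "state_subtraction Z m q Z' \<longleftrightarrow>
     m \<in> nodes Z \<and> q \<in> states (machine Z m) \<and> q \<noteq> start (machine Z m) \<and>
     nodes Z' =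
       nodes Z - {n. \<exists>r. child Z q = Some r \<and> (r, n) \<in> (tree_arcs Z)\<^sup>*} \<and>
     root_node Z' = root_node Z \<and> same_on (nodes Z' - {m}) (all_states Z') Z Z' \<and>
     (let A = machine Z m; A' = machine Z' m in
        states A' = states A - {q} \<and> inputs A' = inputs A \<and>
        outputs A' = outputs A \<and> start A' = start A \<and>
        (\<forall>p\<in>states A'. \<forall>x\<in>inputs A.
           delta A' p x = (if delta A p x = Some q then None else delta A p x) \<and>
           gamma A' p x = gamma A p x))"

definition arc_modification ::
  "('n, 'q, 'x) himm \<Rightarrow> 'n \<Rightarrow> ('n, 'q, 'x) himm \<Rightarrow> bool" where
  "arc_modification Z m Z' \<longleftrightarrow>
     m \<in> nodes Z \<and> nodes Z' = nodes Z \<and> root_node Z' = root_node Z \<and>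
     same_on (nodes Z - {m}) (all_states Z) Z Z' \<and>
     (let A = machine Z m; A' = machine Z' m in
        is_mm A' \<and> states A' = states A \<and> inputs A' = inputs A \<and> outputs A' = outputs A)"

definition composition ::
  "'n \<Rightarrow> ('q, 'x, real) mm \<Rightarrow> 'q list \<Rightarrow> ('n, 'q, 'x) himm list
   \<Rightarrow> ('n, 'q, 'x) himm \<Rightarrow> bool" where
  "composition m A qs Zs Z' \<longleftrightarrow>
     is_mm A \<and> outputs A \<subseteq> {0..} \<and>
     distinct qs \<and> set qs = states A \<and> length Zs \<le> length qs \<and>
     (\<forall>i<length Zs. Sigma_of (Zs ! i) = inputs A \<and> Lambda_of (Zs ! i) = outputs A \<and>
        m \<notin> nodes (Zs ! i) \<and> states A \<inter> all_states (Zs ! i) = {} \<and>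
        (\<forall>j<i. compatible (Zs ! j) (Zs ! i))) \<and>
     nodes Z' = insert m (\<Union>Y\<in>set Zs. nodes Y) \<and>
     root_node Z' = m \<and> machine Z' m = A \<and>
     (\<forall>i<length qs. child Z' (qs ! i) =
        (if i < length Zs then Some (root_node (Zs ! i)) else None)) \<and>
     (\<forall>Y\<in>set Zs. same_on (nodes Y) (all_states Y) Y Z')"

datatype ('n, 'q, 'x) modification =
  State_Addition "('n, 'q, 'x) himm" 'n 'q "('n, 'q, 'x) himm option"
| State_Subtraction "('n, 'q, 'x) himm" 'n 'q
| Arc_Modification "('n, 'q, 'x) himm" 'n
| is_Composition: Composition 'n "('q, 'x, real) mm" "'q list" "('n, 'q, 'x) himm list"

fun yields :: "('n, 'q, 'x) modification \<Rightarrow> ('n, 'q, 'x) himm \<Rightarrow> bool" where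
  "yields (State_Addition Z m q Zadd) Z' = state_addition Z m q Zadd Z'"
| "yields (State_Subtraction Z m q) Z' = state_subtraction Z m q Z'"
| "yields (Arc_Modification Z m) Z' = arc_modification Z m Z'"
| "yields (Composition m A qs Zs) Z' = composition m A qs Zs Z'"

fun given_himms :: "('n, 'q, 'x) modification \<Rightarrow> ('n, 'q, 'x) himm set" where
  "given_himms (State_Addition Z m q Zadd) = insert Z (set_option Zadd)"
| "given_himms (State_Subtraction Z m q) = {Z}"
| "given_himms (Arc_Modification Z m) = {Z}"
| "given_himms (Composition m A qs Zs) = set Zs"

fun modified_node :: "('n, 'q, 'x) modification \<Rightarrow> 'n" where
  "modified_node (State_Addition Z m q Zadd) = m"
| "modified_node (State_Subtraction Z m q) = m"
| "modified_node (Arc_Modification Z m) = m"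
| "modified_node (Composition m A qs Zs) = m"


section \<open>Dijkstra's algorithm\<close>

fun walk :: "('v, 'x, 'c) mm \<Rightarrow> 'v \<Rightarrow> ('v \<times> 'x) list \<Rightarrow> 'v \<Rightarrow> bool" where
  "walk A u [] v = (u = v)"
| "walk A u ((q, y) # w) v =
     (q = u \<and> u \<in> states A \<and> y \<in> inputs A \<and>
      (\<exists>u'. delta A u y = Some u' \<and> walk A u' w v))"

definition walk_cost :: "('v, 'x, ennreal) mm \<Rightarrow> ('v \<times> 'x) list \<Rightarrow> ennreal" where
  "walk_cost A w = (\<Sum>(q, y)\<leftarrow>w. gamma A q y)"

definition min_cost :: "('v, 'x, ennreal) mm \<Rightarrow> 'v \<Rightarrow> ennreal" where
  "min_cost A v = (INF w\<in>{w. walk A (start A) w v}. walk_cost A w)"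

definition num_vertices :: "('v, 'x, 'c) mm \<Rightarrow> nat" where
  "num_vertices A = card (states A)"

definition num_arcs :: "('v, 'x, 'c) mm \<Rightarrow> nat" where
  "num_arcs A = card {(v, y). v \<in> states A \<and> y \<in> inputs A \<and> delta A v y \<noteq> None}"

text \<open>
  The result consists of the distances from the start state and of the last arcs of the paths in
  a shortest path tree.
\<close>

record ('v, 'x) sp_result =
  dist_to :: "'v \<Rightarrow> ennreal"
  pred_arc :: "'v \<Rightarrow> ('v \<times> 'x) option"

inductive tree_path :: "('v \<Rightarrow> ('v \<times> 'x) option) \<Rightarrow> 'v \<Rightarrow> 'v \<Rightarrow> ('v \<times> 'x) list \<Rightarrow> bool"
  for p :: "'v \<Rightarrow> ('v \<times> 'x) option" and s :: 'v where
  "tree_path p s s []"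
| "\<lbrakk>v \<noteq> s; p v = Some (u, y); tree_path p s u w\<rbrakk> \<Longrightarrow> tree_path p s v (w @ [(u, y)])"

definition shortest_paths :: "('v, 'x, ennreal) mm \<Rightarrow> ('v, 'x) sp_result \<Rightarrow> bool" where
  "shortest_paths A r \<longleftrightarrow>
     (\<forall>v\<in>states A. dist_to r v = min_cost A v \<and>
        (min_cost A v < \<infinity> \<longrightarrow>
           (\<exists>w. tree_path (pred_arc r) (start A) v w \<and>
                walk A (start A) w v \<and> walk_cost A w = min_cost A v)))"

text \<open>
  An implementation returns the result and the number of elementary operations performed.
  Its running time is in \<open>O(E + V log V)\<close>. The summand 1 is relevant only for a graph
  with a single vertex and no arcs, where \<open>E + V log V\<close> vanishes.
\<close>

definition dijkstra_fibonacci ::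
  "(('v, 'x, ennreal) mm \<Rightarrow> ('v, 'x) sp_result \<times> nat) \<Rightarrow> bool" where
  "dijkstra_fibonacci D \<longleftrightarrow>
     (\<forall>A. is_mm A \<longrightarrow> shortest_paths A (fst (D A))) \<and>
     (\<exists>K. \<forall>A. is_mm A \<longrightarrow>
        real (snd (D A)) \<le>
          K * (real (num_arcs A) + real (num_vertices A) * log 2 (real (num_vertices A)) + 1))"


section \<open>Augmented machines\<close>

datatype ('q, 'x) aug_state = St 'q | Exit 'x

type_synonym ('q, 'x) exit_values =
  "'x \<Rightarrow> ennreal \<times> (('q, 'x) aug_state \<times> 'x) list option"

fun aug_delta ::
  "('q, 'x, real) mm \<Rightarrow> ('q, 'x) aug_state \<Rightarrow> 'x \<Rightarrow> ('q, 'x) aug_state option" where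
  "aug_delta A (St q) y =
     (case delta A q y of Some v \<Rightarrow> Some (St v) | None \<Rightarrow> Some (Exit y))"
| "aug_delta A (Exit x) y = None"

fun aug_gamma ::
  "('q, 'x, real) mm \<Rightarrow> ('q \<Rightarrow> ('q, 'x) exit_values) \<Rightarrow> ('q, 'x) aug_state \<Rightarrow> 'x
   \<Rightarrow> ennreal" where
  "aug_gamma A e (St q) y =
     (case delta A q y of
        Some v \<Rightarrow> fst (e q y) + ennreal (gamma A q y)
      | None \<Rightarrow> fst (e q y))"
| "aug_gamma A e (Exit x) y = 0"

definition augment ::
  "('q, 'x, real) mm \<Rightarrow> ('q \<Rightarrow> ('q, 'x) exit_values)
   \<Rightarrow> (('q, 'x) aug_state, 'x, ennreal) mm" where
  "augment A e =
     (let S = St ` states A \<union> Exit ` inputs A in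
      \<lparr>states = S, inputs = inputs A,
       outputs = (\<lambda>(v, y). aug_gamma A e v y) ` (S \<times> inputs A),
       delta = aug_delta A, gamma = aug_gamma A e, start = St (start A)\<rparr>)"

text \<open>
  Creating the states takes one operation each. For every pair of a state and an input, one tests
  whether the transition is defined, sets the new transition, adds the two costs if
  the transition is defined, and sets the new cost.
\<close>

definition augment_time :: "('q, 'x, real) mm \<Rightarrow> nat" where
  "augment_time A =
     card (states A) + card (inputs A) +
     (\<Sum>q\<in>states A. \<Sum>y\<in>inputs A. if delta A q y \<noteq> None then 4 else 3)"

definition read_exits ::
  "('q, 'x, real) mm \<Rightarrow> (('q, 'x) aug_state, 'x) sp_result \<Rightarrow> ('q, 'x) exit_values" where
  "read_exits A r = (\<lambda>x.
     (dist_to r (Exit x),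
      if dist_to r (Exit x) = \<infinity> then None
      else Some (THE w. tree_path (pred_arc r) (St (start A)) (Exit x) w)))"

text \<open>An optimal trajectory is read off arc by arc.\<close>

definition read_time :: "'x set \<Rightarrow> ('q, 'x) exit_values \<Rightarrow> nat" where
  "read_time S r =
     (\<Sum>x\<in>S. 1 + (case snd (r x) of None \<Rightarrow> 0 | Some w \<Rightarrow> length w))"


section \<open>The Optimal Exit Computer\<close>

text \<open>
  The marks and stored values of all machines, including those of several HiMMs with
  disjoint sets of nodes. A modification does not change the memory.
\<close>

record ('n, 'q, 'x) memory =
  marked :: "'n \<Rightarrow> bool"
  stored :: "'n \<Rightarrow> ('q, 'x) exit_values option"

definition up_to_date :: "('n, 'q, 'x) memory \<Rightarrow> ('n, 'q, 'x) himm \<Rightarrow> bool" where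
  "up_to_date \<mu> Z \<longleftrightarrow>
     (\<forall>n\<in>nodes Z. \<not> marked \<mu> n \<and>
        (\<exists>r. stored \<mu> n = Some r \<and> (\<forall>x\<in>Sigma_of Z. fst (r x) = opt_exit_cost Z n x)))"

definition nodes_to_mark ::
  "('n, 'q, 'x) modification \<Rightarrow> ('n, 'q, 'x) himm \<Rightarrow> 'n set" where
  "nodes_to_mark md Z' =
     (if is_Composition md then {modified_node md}
      else {a. (a, modified_node md) \<in> (tree_arcs Z')\<^sup>*})"

definition mark ::
  "('n, 'q, 'x) modification \<Rightarrow> ('n, 'q, 'x) himm \<Rightarrow> ('n, 'q, 'x) memory
   \<Rightarrow> ('n, 'q, 'x) memory" where
  "mark md Z' \<mu> = \<mu>\<lparr>marked := (\<lambda>n. n \<in> nodes_to_mark md Z' \<or> marked \<mu> n)\<rparr>"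

text \<open>For each machine: set the mark and look up the parent.\<close>

definition mark_time :: "('n, 'q, 'x) modification \<Rightarrow> ('n, 'q, 'x) himm \<Rightarrow> nat" where
  "mark_time md Z' = 2 * card (nodes_to_mark md Z')"

text \<open>
  \<open>optimal_exit D Z \<mu> m r \<mu>' t\<close>: started in the memory \<open>\<mu>\<close>, the call for
  the node \<open>m\<close> returns \<open>r\<close> after \<open>t\<close> operations and leaves the memory
  \<open>\<mu>'\<close>. The states of a machine may be treated in any order.
  Every visit tests the mark; returning or receiving the values for a node
  takes one operation per input. In the second rule, storing takes two operations per
  input and removing the mark takes one.
\<close>

inductive
  optimal_exit ::
    "((('q, 'x) aug_state, 'x, ennreal) mm \<Rightarrow> (('q, 'x) aug_state, 'x) sp_result \<times> nat)
     \<Rightarrow> ('n, 'q, 'x) himm \<Rightarrow> ('n, 'q, 'x) memory \<Rightarrow> 'n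
     \<Rightarrow> ('q, 'x) exit_values \<Rightarrow> ('n, 'q, 'x) memory \<Rightarrow> nat \<Rightarrow> bool"
  and child_exits ::
    "((('q, 'x) aug_state, 'x, ennreal) mm \<Rightarrow> (('q, 'x) aug_state, 'x) sp_result \<times> nat)
     \<Rightarrow> ('n, 'q, 'x) himm \<Rightarrow> ('n, 'q, 'x) memory \<Rightarrow> 'q list
     \<Rightarrow> ('q \<Rightarrow> ('q, 'x) exit_values) \<Rightarrow> ('n, 'q, 'x) memory \<Rightarrow> nat \<Rightarrow> bool"
  for D :: "(('q, 'x) aug_state, 'x, ennreal) mm \<Rightarrow> (('q, 'x) aug_state, 'x) sp_result \<times> nat"
  and Z :: "('n, 'q, 'x) himm"
where
  unmarked:
    "\<lbrakk>\<not> marked \<mu> m; stored \<mu> m = Some r\<rbrakk>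
     \<Longrightarrow> optimal_exit D Z \<mu> m r \<mu> (1 + card (Sigma_of Z))"
| compute:
    "\<lbrakk>marked \<mu> m; distinct qs; set qs = states (machine Z m);
      child_exits D Z \<mu> qs e \<mu>1 t1;
      D (augment (machine Z m) e) = (res, t2);
      r = read_exits (machine Z m) res;
      \<mu>' = \<mu>1\<lparr>marked := (marked \<mu>1)(m := False), stored := (stored \<mu>1)(m := Some r)\<rparr>;
      t = 1 + t1 + augment_time (machine Z m) + t2 + read_time (Sigma_of Z) r
          + 2 * card (Sigma_of Z) + 1 + card (Sigma_of Z)\<rbrakk>
     \<Longrightarrow> optimal_exit D Z \<mu> m r \<mu>' t"
| no_states:
    "child_exits D Z \<mu> [] (\<lambda>_ _. (0, None)) \<mu> 0"
| terminal_state: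
    "\<lbrakk>child Z q = None; child_exits D Z \<mu> qs e \<mu>' t\<rbrakk>
     \<Longrightarrow> child_exits D Z \<mu> (q # qs) (e(q := \<lambda>_. (0, None))) \<mu>'
           (1 + card (Sigma_of Z) + t)"
| refined_state:
    "\<lbrakk>child Z q = Some n; optimal_exit D Z \<mu> n r \<mu>1 t1; child_exits D Z \<mu>1 qs e \<mu>2 t2\<rbrakk>
     \<Longrightarrow> child_exits D Z \<mu> (q # qs) (e(q := r)) \<mu>2
           (1 + t1 + card (Sigma_of Z) + t2)"

definition optimal_exit_computer ::
  "((('q, 'x) aug_state, 'x, ennreal) mm \<Rightarrow> (('q, 'x) aug_state, 'x) sp_result \<times> nat)
   \<Rightarrow> ('n, 'q, 'x) modification \<Rightarrow> ('n, 'q, 'x) himm \<Rightarrow> ('n, 'q, 'x) memory \<Rightarrow> nat \<Rightarrow> bool" where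
  "optimal_exit_computer D md Z' \<mu> t \<longleftrightarrow>
     (\<exists>r \<mu>' t'. optimal_exit D Z' (mark md Z' \<mu>) (root_node Z') r \<mu>' t' \<and>
        t = mark_time md Z' + t')"

definition runs_within ::
  "((('q, 'x) aug_state, 'x, ennreal) mm \<Rightarrow> (('q, 'x) aug_state, 'x) sp_result \<times> nat)
   \<Rightarrow> ('n, 'q, 'x) modification \<Rightarrow> ('n, 'q, 'x) himm \<Rightarrow> ('n, 'q, 'x) memory \<Rightarrow> real \<Rightarrow> bool" where
  "runs_within D md Z' \<mu> b \<longleftrightarrow>
     (\<exists>t. optimal_exit_computer D md Z' \<mu> t) \<and>
     (\<forall>t. optimal_exit_computer D md Z' \<mu> t \<longrightarrow> real t \<le> b)"

definition layer_bound :: "('n, 'q, 'x) himm \<Rightarrow> real" where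
  "layer_bound Z =
     (let b = real (max_states Z); s = real (card (Sigma_of Z))
      in b * s + (b + s) * log 2 (b + s))"

end

theory Submission
  imports Defs
begin

text \<open>
  Marking touches only the modified machine and, unless the modification is a composition, its
  ancestors, which form a chain of at most \<open>depth Z\<close> machines. A call at a marked machine
  builds an augmented machine with at most \<open>b + s\<close> vertices and \<open>b * s\<close> arcs, where
  \<open>b\<close> is the largest number of states and \<open>s\<close> the number of inputs. It reads off at most
  \<open>s\<close> paths, each of length at most \<open>b\<close> because shortest path trees have no cycles, and
  removes one mark. A call at an unmarked machine takes \<open>1 + s\<close> operations. So the number of
  marks is a potential, and the whole run costs at most the number of marks times the cost of one
  layer.
\<close>

section \<open>Modifications preserve hierarchical machines\<close>

text \<open>Only the HiMMs given to a modification are assumed to be HiMMs, whereas the bounds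
  concern the modified one. Acyclicity, unique parents and the finiteness behind the maximum in
  \<open>depth\<close> are needed there, so each modification has to be shown to produce a HiMM
  again. Correctness of the stored costs is never at stake: it only matters that values are stored,
  and from Dijkstra's algorithm only the time bound and the shape of the paths are used.
  \<open>runs_within\<close> also asks for a run to exist, so no call may reach an unmarked machine
  without stored values. The cost of one layer first comes out as a multiple of
  \<open>layer_bound Z\<close> plus \<open>b + s + 1\<close>. The extra terms are absorbed when
  \<open>2 \<le> b + s\<close>; the claim about bounded machines keeps them and thus also covers a
  single state without inputs.\<close>

lemma in_all_states: "p \<in> all_states Z \<longleftrightarrow> (\<exists>n\<in>nodes Z. p \<in> states (machine Z n))"
  by (auto simp: all_states_def)

lemma tree_arcs_iff:
  "(m, n) \<in> tree_arcs Z \<longleftrightarrow>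
     m \<in> nodes Z \<and> (\<exists>q. q \<in> states (machine Z m) \<and> child Z q = Some n)"
  by (auto simp: tree_arcs_def)

lemma rtrancl_subset_mono: "(a, b) \<in> R\<^sup>* \<Longrightarrow> R \<subseteq> S \<Longrightarrow> (a, b) \<in> S\<^sup>*"
  using rtrancl_mono by blast

lemma is_himmD:
  assumes "is_himm Z"
  shows "finite (nodes Z)" "root_node Z \<in> nodes Z"
    and "n \<in> nodes Z \<Longrightarrow> is_mm (machine Z n)"
    and "n \<in> nodes Z \<Longrightarrow> inputs (machine Z n) = Sigma_of Z"
    and "n \<in> nodes Z \<Longrightarrow> outputs (machine Z n) = Lambda_of Z"
    and "Lambda_of Z \<subseteq> {0..}"
    and "\<lbrakk>m \<in> nodes Z; n \<in> nodes Z; p \<in> states (machine Z m); p \<in> states (machine Z n)\<rbrakk>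
      \<Longrightarrow> m = n"
    and "\<lbrakk>p \<in> all_states Z; child Z p = Some n\<rbrakk> \<Longrightarrow> n \<in> nodes Z"
    and "p \<in> all_states Z \<Longrightarrow> child Z p \<noteq> Some (root_node Z)"
    and "\<lbrakk>p \<in> all_states Z; child Z p = Some n; p' \<in> all_states Z; child Z p' = Some n\<rbrakk>
      \<Longrightarrow> p = p'"
    and "n \<in> nodes Z \<Longrightarrow> (root_node Z, n) \<in> (tree_arcs Z)\<^sup>*"
proof -
  note h = assms[unfolded is_himm_def is_rooted_tree_def]
  show "finite (nodes Z)" "root_node Z \<in> nodes Z" "Lambda_of Z \<subseteq> {0..}"
    and "n \<in> nodes Z \<Longrightarrow> is_mm (machine Z n)"
    and "n \<in> nodes Z \<Longrightarrow> inputs (machine Z n) = Sigma_of Z"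
    and "n \<in> nodes Z \<Longrightarrow> outputs (machine Z n) = Lambda_of Z"
    and "\<lbrakk>p \<in> all_states Z; child Z p = Some n\<rbrakk> \<Longrightarrow> n \<in> nodes Z"
    and "p \<in> all_states Z \<Longrightarrow> child Z p \<noteq> Some (root_node Z)"
    and "n \<in> nodes Z \<Longrightarrow> (root_node Z, n) \<in> (tree_arcs Z)\<^sup>*"
    using h by auto
  show "\<lbrakk>m \<in> nodes Z; n \<in> nodes Z; p \<in> states (machine Z m); p \<in> states (machine Z n)\<rbrakk>
      \<Longrightarrow> m = n"
    using h by blast
  show "\<lbrakk>p \<in> all_states Z; child Z p = Some n; p' \<in> all_states Z; child Z p' = Some n\<rbrakk>
      \<Longrightarrow> p = p'"
    using h by (metis Diff_iff singletonD)
qed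

text \<open>The last arc of a path from the root to \<open>n\<close> supplies a parent state, so
  existence comes from reachability and only uniqueness has to be checked. \<open>S\<close> and
  \<open>L\<close> stand for the alphabets that \<open>is_himm\<close> reads off the root.\<close>

lemma is_himmI:
  assumes "finite (nodes Z)" "root_node Z \<in> nodes Z"
    and "\<And>n. n \<in> nodes Z \<Longrightarrow> is_mm (machine Z n)"
    and "\<And>n. n \<in> nodes Z \<Longrightarrow> inputs (machine Z n) = S"
    and "\<And>n. n \<in> nodes Z \<Longrightarrow> outputs (machine Z n) = L"
    and "L \<subseteq> {0..}"
    and "\<And>m n p. \<lbrakk>m \<in> nodes Z; n \<in> nodes Z; p \<in> states (machine Z m);
      p \<in> states (machine Z n)\<rbrakk> \<Longrightarrow> m = n"
    and "\<And>p n. \<lbrakk>p \<in> all_states Z; child Z p = Some n\<rbrakk> \<Longrightarrow> n \<in> nodes Z \<and> n \<noteq> root_node Z"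
    and "\<And>p p' n. \<lbrakk>p \<in> all_states Z; child Z p = Some n; p' \<in> all_states Z;
      child Z p' = Some n\<rbrakk> \<Longrightarrow> p = p'"
    and reach: "\<And>n. n \<in> nodes Z \<Longrightarrow> (root_node Z, n) \<in> (tree_arcs Z)\<^sup>*"
  shows "is_himm Z"
proof -
  have ex: "\<exists>p. p \<in> all_states Z \<and> child Z p = Some n" if "n \<in> nodes Z" "n \<noteq> root_node Z" for n
    using reach[OF that(1)] that(2)
    by (cases rule: rtranclE) (auto simp: tree_arcs_iff in_all_states)
  have SL: "Sigma_of Z = S" "Lambda_of Z = L"
    using assms(2,4,5) by (auto simp: Sigma_of_def Lambda_of_def)
  have "is_rooted_tree Z"
    unfolding is_rooted_tree_def using assms(2,8,9) reach ex by (auto intro!: ex_ex1I)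
  then show ?thesis
    unfolding is_himm_def SL using assms(1,3-7) by blast
qed

text \<open>Covers arc modification, where no state is new, and state addition before anything hangs
  below the new state: old arcs survive and new states are terminal, so the tree stays the
  same.\<close>

lemma is_himm_replace_machine:
  assumes Z: "is_himm Z" and m: "m \<in> nodes Z"
    and nodes: "nodes Z' = nodes Z" and root: "root_node Z' = root_node Z"
    and same: "same_on (nodes Z - {m}) (all_states Z) Z Z'"
    and mm: "is_mm (machine Z' m)"
    and io: "inputs (machine Z' m) = inputs (machine Z m)"
      "outputs (machine Z' m) = outputs (machine Z m)"
    and old: "states (machine Z m) \<subseteq> states (machine Z' m)"
    and new: "\<And>p. \<lbrakk>p \<in> states (machine Z' m); p \<notin> states (machine Z m)\<rbrakk>
      \<Longrightarrow> p \<notin> all_states Z \<and> child Z' p = None"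
  shows "is_himm Z'"
proof -
  note H = is_himmD[OF Z]
  have mach: "machine Z' n = machine Z n" if "n \<in> nodes Z" "n \<noteq> m" for n
    using same that by (auto simp: same_on_def)
  have ch: "child Z' p = child Z p" if "p \<in> all_states Z" for p
    using same that by (auto simp: same_on_def)
  have st: "states (machine Z n) \<subseteq> states (machine Z' n)" if "n \<in> nodes Z" for n
    using mach old that by (cases "n = m") auto
  have st_old: "p \<in> states (machine Z n)"
    if "n \<in> nodes Z" "p \<in> states (machine Z' n)" "p \<in> all_states Z" for n p
    using that mach[of n] new by (cases "n = m") auto
  have st_new: "n = m"
    if "n \<in> nodes Z" "p \<in> states (machine Z' n)" "p \<notin> all_states Z" for n p
    using that mach[of n] by (cases "n = m") (auto simp: in_all_states)
  have arc: "p \<in> all_states Z \<and> child Z p = Some n"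
    if "p \<in> all_states Z'" "child Z' p = Some n" for p n
  proof -
    have "p \<in> all_states Z"
      using that st_new new by (metis in_all_states nodes option.distinct(1))
    then show ?thesis using ch that by auto
  qed
  have sub: "tree_arcs Z \<subseteq> tree_arcs Z'"
  proof clarify
    fix a b assume "(a, b) \<in> tree_arcs Z"
    then show "(a, b) \<in> tree_arcs Z'"
      using st ch unfolding tree_arcs_iff nodes by (metis in_all_states subsetD)
  qed
  show ?thesis
  proof (rule is_himmI[where S = "Sigma_of Z" and L = "Lambda_of Z"])
    show "finite (nodes Z')" "root_node Z' \<in> nodes Z'" "Lambda_of Z \<subseteq> {0..}"
      using H nodes root by auto
    fix n assume n: "n \<in> nodes Z'"
    show "is_mm (machine Z' n)"
      using n H(3) mm mach nodes by (cases "n = m") auto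
    show "inputs (machine Z' n) = Sigma_of Z"
      using n H(4) io mach nodes m by (cases "n = m") auto
    show "outputs (machine Z' n) = Lambda_of Z"
      using n H(5) io mach nodes m by (cases "n = m") auto
    show "(root_node Z', n) \<in> (tree_arcs Z')\<^sup>*"
      using n H(11) nodes root rtrancl_subset_mono[OF _ sub] by metis
  next
    fix k n p
    assume "k \<in> nodes Z'" "n \<in> nodes Z'" "p \<in> states (machine Z' k)" "p \<in> states (machine Z' n)"
    then show "k = n"
      using H(7) st_old st_new nodes by (cases "p \<in> all_states Z") metis+
  next
    fix p n assume "p \<in> all_states Z'" "child Z' p = Some n"
    then show "n \<in> nodes Z' \<and> n \<noteq> root_node Z'"
      using arc H(8,9) nodes root by metis
  next
    fix p p' n
    assume "p \<in> all_states Z'" "child Z' p = Some n" "p' \<in> all_states Z'" "child Z' p' = Some n"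
    then show "p = p'" using arc H(10) by metis
  qed
qed

text \<open>The common step of state addition and composition: a terminal arc is redirected to the
  root of a disjoint tree.\<close>

lemma is_himm_graft:
  assumes Z: "is_himm Z" and Y: "is_himm Y" and comp: "compatible Y Z"
    and q: "q \<in> terminal_states Z"
    and nodes: "nodes Z' = nodes Z \<union> nodes Y" and root: "root_node Z' = root_node Z"
    and sameZ: "same_on (nodes Z) (all_states Z - {q}) Z Z'"
    and sameY: "same_on (nodes Y) (all_states Y) Y Z'"
    and chq: "child Z' q = Some (root_node Y)"
  shows "is_himm Z'"
proof -
  note H = is_himmD[OF Z] and HY = is_himmD[OF Y]
  have dis: "nodes Y \<inter> nodes Z = {}" "all_states Y \<inter> all_states Z = {}"
    and SL: "Sigma_of Y = Sigma_of Z" "Lambda_of Y = Lambda_of Z"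
    using comp by (auto simp: compatible_def)
  have machZ: "machine Z' n = machine Z n" if "n \<in> nodes Z" for n
    using sameZ that by (auto simp: same_on_def)
  have machY: "machine Z' n = machine Y n" if "n \<in> nodes Y" for n
    using sameY that by (auto simp: same_on_def)
  have chZ: "child Z' p = child Z p" if "p \<in> all_states Z" "p \<noteq> q" for p
    using sameZ that by (auto simp: same_on_def)
  have chY: "child Z' p = child Y p" if "p \<in> all_states Y" for p
    using sameY that by (auto simp: same_on_def)
  have as: "all_states Z' = all_states Z \<union> all_states Y"
    by (simp add: all_states_def nodes UN_Un machZ machY)
  have qZ: "q \<in> all_states Z" "child Z q = None" using q by (auto simp: terminal_states_def)
  \<comment> \<open>The three alternatives have disjoint sets of targets, so uniqueness of parent
    states reduces to uniqueness within \<open>Z\<close> and within \<open>Y\<close>.\<close>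
  have arc: "p \<in> all_states Z \<and> child Z p = Some n \<and> n \<in> nodes Z \<and> n \<noteq> root_node Z
      \<or> p \<in> all_states Y \<and> child Y p = Some n \<and> n \<in> nodes Y \<and> n \<noteq> root_node Y
      \<or> p = q \<and> n = root_node Y"
    if "p \<in> all_states Z'" "child Z' p = Some n" for p n
  proof (cases "p = q")
    case False
    show ?thesis
    proof (cases "p \<in> all_states Z")
      case True
      then show ?thesis using H(8)[of p n] H(9)[of p] chZ that False by auto
    next
      case f: False
      then have "p \<in> all_states Y" using that as by auto
      then show ?thesis using HY(8)[of p n] HY(9)[of p] chY that by auto
    qed
  qed (use chq that in auto)
  have subZ: "tree_arcs Z \<subseteq> tree_arcs Z'"
  proof clarify
    fix a b assume "(a, b) \<in> tree_arcs Z"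
    then obtain p where p: "a \<in> nodes Z" "p \<in> states (machine Z a)" "child Z p = Some b"
      by (auto simp: tree_arcs_iff)
    then have "p \<in> all_states Z" "p \<noteq> q" using qZ by (auto simp: in_all_states)
    then show "(a, b) \<in> tree_arcs Z'"
      using p chZ[of p] machZ nodes by (auto simp: tree_arcs_iff)
  qed
  have subY: "tree_arcs Y \<subseteq> tree_arcs Z'"
  proof clarify
    fix a b assume "(a, b) \<in> tree_arcs Y"
    then obtain p where p: "a \<in> nodes Y" "p \<in> states (machine Y a)" "child Y p = Some b"
      by (auto simp: tree_arcs_iff)
    then have "p \<in> all_states Y" by (auto simp: in_all_states)
    then show "(a, b) \<in> tree_arcs Z'"
      using p chY[of p] machY nodes by (auto simp: tree_arcs_iff)
  qed
  obtain m where m: "m \<in> nodes Z" "q \<in> states (machine Z m)"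
    using qZ by (auto simp: in_all_states)
  have marc: "(m, root_node Y) \<in> tree_arcs Z'"
    using m machZ chq nodes by (auto simp: tree_arcs_iff)
  have reachZ: "(root_node Z', n) \<in> (tree_arcs Z')\<^sup>*" if "n \<in> nodes Z" for n
    using H(11)[OF that] rtrancl_subset_mono[OF _ subZ] root by metis
  show ?thesis
  proof (rule is_himmI[where S = "Sigma_of Z" and L = "Lambda_of Z"])
    show "finite (nodes Z')" "root_node Z' \<in> nodes Z'" "Lambda_of Z \<subseteq> {0..}"
      using H HY nodes root by auto
    fix n assume n: "n \<in> nodes Z'"
    show "is_mm (machine Z' n)" "inputs (machine Z' n) = Sigma_of Z"
      "outputs (machine Z' n) = Lambda_of Z"
      using n H(3-5)[of n] HY(3-5)[of n] machZ[of n] machY[of n] nodes SL by auto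
    show "(root_node Z', n) \<in> (tree_arcs Z')\<^sup>*"
    proof (cases "n \<in> nodes Z")
      case False
      then have "(root_node Y, n) \<in> (tree_arcs Z')\<^sup>*"
        using n nodes HY(11) rtrancl_subset_mono[OF _ subY] by auto
      then show ?thesis
        using reachZ[OF m(1)] marc by (meson converse_rtrancl_into_rtrancl rtrancl_trans)
    qed (use reachZ in auto)
  next
    fix k n p
    assume a: "k \<in> nodes Z'" "n \<in> nodes Z'" "p \<in> states (machine Z' k)"
      "p \<in> states (machine Z' n)"
    have "i \<in> nodes Z \<and> p \<in> states (machine Z i)"
      if "p \<in> all_states Z" "i \<in> nodes Z'" "p \<in> states (machine Z' i)" for i
      using that machY machZ dis nodes by (force simp: in_all_states)
    moreover have "i \<in> nodes Y \<and> p \<in> states (machine Y i)"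
      if "p \<notin> all_states Z" "i \<in> nodes Z'" "p \<in> states (machine Z' i)" for i
      using that machY machZ nodes by (force simp: in_all_states)
    ultimately show "k = n" using a H(7) HY(7) by (cases "p \<in> all_states Z") metis+
  next
    fix p n assume "p \<in> all_states Z'" "child Z' p = Some n"
    then show "n \<in> nodes Z' \<and> n \<noteq> root_node Z'"
      using arc[of p n] HY(2) H(2) dis nodes root by auto
  next
    fix p p' n
    assume a: "p \<in> all_states Z'" "child Z' p = Some n" "p' \<in> all_states Z'"
      "child Z' p' = Some n"
    show "p = p'"
      using arc[OF a(1,2)] arc[OF a(3,4)] H(10)[of p n p'] HY(10)[of p n p'] dis HY(2) by blast
  qed
qed

lemma is_himm_state_addition:
  assumes add: "state_addition Z m q Zadd Z'" and Z: "is_himm Z"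
    and Y: "\<And>Y. Zadd = Some Y \<Longrightarrow> is_himm Y"
  shows "is_himm Z'"
proof -
  \<comment> \<open>\<open>Z1\<close> is \<open>Z'\<close> with the added tree cut off and
    \<open>q\<close> terminal; it separates the change of one machine from the grafting.\<close>
  define Z1 where "Z1 = Z'\<lparr>nodes := nodes Z, child := (child Z')(q := None)\<rparr>"
  have f: "m \<in> nodes Z" "q \<notin> all_states Z" "root_node Z' = root_node Z"
    "same_on (nodes Z - {m}) (all_states Z) Z Z'" "is_mm (machine Z' m)"
    "states (machine Z' m) = insert q (states (machine Z m))"
    "inputs (machine Z' m) = inputs (machine Z m)"
    "outputs (machine Z' m) = outputs (machine Z m)"
    using add by (auto simp: state_addition_def Let_def)
  have Z1: "is_himm Z1"
    by (rule is_himm_replace_machine[OF Z f(1)])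
      (use f in \<open>auto simp: Z1_def same_on_def\<close>)
  show ?thesis
  proof (cases Zadd)
    case None
    then have "nodes Z' = nodes Z" "child Z' q = None"
      using add by (auto simp: state_addition_def)
    then have "Z' = Z1" by (intro himm.equality) (auto simp: Z1_def)
    then show ?thesis using Z1 by simp
  next
    case (Some Y)
    then have g: "compatible Y Z" "q \<notin> all_states Y" "nodes Z' = nodes Z \<union> nodes Y"
      "child Z' q = Some (root_node Y)" "same_on (nodes Y) (all_states Y) Y Z'"
      using add by (auto simp: state_addition_def)
    have "states (machine Z' n) = (if n = m then insert q (states (machine Z m))
        else states (machine Z n))" if "n \<in> nodes Z" for n
      using that f by (auto simp: same_on_def)
    then have "p \<in> all_states Z1 \<longleftrightarrow> p = q \<or> p \<in> all_states Z" for p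
      using f(1) unfolding in_all_states by (fastforce simp: Z1_def split: if_splits)
    then have as: "all_states Z1 = insert q (all_states Z)" by blast
    have SL: "Sigma_of Z1 = Sigma_of Z" "Lambda_of Z1 = Lambda_of Z"
      using is_himmD(4,5)[OF Z1 is_himmD(2)[OF Z1]] is_himmD(2,4,5)[OF Z] is_himmD(4,5)[OF Z1, of m]
        f by (auto simp: Z1_def)
    have "compatible Y Z1"
      using g as SL by (auto simp: compatible_def Z1_def)
    then show ?thesis
      by (rule is_himm_graft[OF Z1 Y[OF Some], where q = q])
        (use g f as in \<open>auto simp: Z1_def same_on_def terminal_states_def\<close>)
  qed
qed

section \<open>Arcs of the tree: unique sources and acyclicity\<close>

lemma tree_arc_unique_source:
  assumes "is_himm Z" "(a, n) \<in> tree_arcs Z" "(b, n) \<in> tree_arcs Z"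
  shows "a = b"
proof -
  obtain p p' where "a \<in> nodes Z" "p \<in> states (machine Z a)" "child Z p = Some n"
    "b \<in> nodes Z" "p' \<in> states (machine Z b)" "child Z p' = Some n"
    using assms by (auto simp: tree_arcs_iff)
  moreover from this have "p = p'"
    using is_himmD(10)[OF assms(1)] by (metis in_all_states)
  ultimately show ?thesis using is_himmD(7)[OF assms(1)] by metis
qed

lemma tree_arc_not_root:
  assumes "is_himm Z"
  shows "(a, root_node Z) \<notin> tree_arcs Z"
  using is_himmD(9)[OF assms] by (metis in_all_states tree_arcs_iff)

lemma tree_arc_nodes:
  assumes "is_himm Z" "(a, b) \<in> tree_arcs Z"
  shows "a \<in> nodes Z" "b \<in> nodes Z"
  using is_himmD(8)[OF assms(1)] assms(2) by (metis in_all_states tree_arcs_iff)+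

text \<open>A cycle through \<open>n\<close> enters \<open>n\<close> from its only parent and
  therefore also passes through that parent. So along the path from the root, each node inherits the
  absence of cycles from its parent, and nothing enters the root.\<close>

lemma acyclic_tree_arcs:
  assumes Z: "is_himm Z"
  shows "acyclic (tree_arcs Z)"
proof -
  have "(n, n) \<notin> (tree_arcs Z)\<^sup>+" if "n \<in> nodes Z" for n
    using is_himmD(11)[OF Z that]
  proof (induction rule: rtrancl_induct)
    case base
    then show ?case using tree_arc_not_root[OF Z] by (metis tranclE)
  next
    case (step k n)
    show ?case
    proof
      assume "(n, n) \<in> (tree_arcs Z)\<^sup>+"
      then obtain k' where k': "(n, k') \<in> (tree_arcs Z)\<^sup>*" "(k', n) \<in> tree_arcs Z"
        by (meson tranclD2)
      then have "k' = k" using step tree_arc_unique_source[OF Z] by metis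
      then have "(k, k) \<in> (tree_arcs Z)\<^sup>+" using k' step by (metis rtrancl_into_trancl2)
      then show False using step by simp
    qed
  qed
  moreover have "n \<in> nodes Z" if "(n, n) \<in> (tree_arcs Z)\<^sup>+" for n
    using that tree_arc_nodes[OF Z] by (meson tranclE)
  ultimately show ?thesis by (auto simp: acyclic_def)
qed

text \<open>If \<open>m\<close> lay below \<open>q\<close>, the \<open>q\<close>-arc out of
  \<open>m\<close> would close a cycle.\<close>

lemma state_subtraction_modified_node:
  assumes sub: "state_subtraction Z m q Z'" and Z: "is_himm Z"
  shows "m \<in> nodes Z'"
proof -
  have "(m, m) \<in> (tree_arcs Z)\<^sup>+" if "child Z q = Some r" "(r, m) \<in> (tree_arcs Z)\<^sup>*" for r
  proof -
    have "(m, r) \<in> tree_arcs Z"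
      using that sub by (auto simp: state_subtraction_def tree_arcs_iff)
    then show ?thesis using that by (auto intro: rtrancl_into_trancl2)
  qed
  then show ?thesis
    using acyclic_tree_arcs[OF Z] sub by (auto simp: state_subtraction_def acyclic_def)
qed

text \<open>The removed machines are closed under descent, and the \<open>q\<close>-arc is the only
  arc that enters them from outside. Hence paths from the root to surviving machines
  survive.\<close>

lemma is_himm_state_subtraction:
  assumes sub: "state_subtraction Z m q Z'" and Z: "is_himm Z"
  shows "is_himm Z'"
proof -
  note H = is_himmD[OF Z]
  have f: "m \<in> nodes Z" "q \<in> states (machine Z m)" "q \<noteq> start (machine Z m)"
    "nodes Z' = nodes Z - {n. \<exists>r. child Z q = Some r \<and> (r, n) \<in> (tree_arcs Z)\<^sup>*}"
    "root_node Z' = root_node Z" "same_on (nodes Z' - {m}) (all_states Z') Z Z'"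
    "states (machine Z' m) = states (machine Z m) - {q}"
    "inputs (machine Z' m) = inputs (machine Z m)"
    "outputs (machine Z' m) = outputs (machine Z m)"
    "start (machine Z' m) = start (machine Z m)"
    "\<And>p x. p \<in> states (machine Z' m) \<Longrightarrow> x \<in> inputs (machine Z m) \<Longrightarrow>
       delta (machine Z' m) p x =
         (if delta (machine Z m) p x = Some q then None else delta (machine Z m) p x) \<and>
       gamma (machine Z' m) p x = gamma (machine Z m) p x"
    using sub by (auto simp: state_subtraction_def Let_def)
  have mach: "machine Z' n = machine Z n" if "n \<in> nodes Z'" "n \<noteq> m" for n
    using f(6) that by (auto simp: same_on_def)
  have ch: "child Z' p = child Z p" if "p \<in> all_states Z'" for p
    using f(6) that by (auto simp: same_on_def)
  have subn: "nodes Z' \<subseteq> nodes Z" using f(4) by auto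
  have st: "states (machine Z' n) = states (machine Z n) - {q}" if "n \<in> nodes Z'" for n
    using that f(1,2,7) H(7)[of n m q] mach subn by (cases "n = m") auto
  have as: "p \<in> all_states Z" "p \<noteq> q" if "p \<in> all_states Z'" for p
    using that st subn by (auto simp: in_all_states)
  have par: "n \<in> nodes Z' \<and> (k, n) \<in> tree_arcs Z'"
    if k: "k \<in> nodes Z'" and p: "p \<in> states (machine Z k)" "p \<noteq> q" "child Z p = Some n" for k p n
  proof -
    have pas: "p \<in> all_states Z" and arc: "(k, n) \<in> tree_arcs Z"
      using k p subn by (auto simp: in_all_states tree_arcs_iff)
    \<comment> \<open>If \<open>n\<close> were removed, then either it is the root of the removed
      tree and \<open>p = q\<close> because parent states are unique, or its only parent
      \<open>k\<close> was removed as well.\<close>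
    have "False" if r: "child Z q = Some r" "(r, n) \<in> (tree_arcs Z)\<^sup>*" for r
      using r(2)
    proof (cases rule: rtranclE)
      case base
      then have "p = q" using H(10)[OF pas p(3), of q] r f(1,2) by (auto simp: in_all_states)
      then show False using p by simp
    next
      case (step l)
      then have "l = k" using tree_arc_unique_source[OF Z] arc by metis
      then show False using step k r f(4) by auto
    qed
    then have "n \<in> nodes Z'" using f(4) H(8)[OF pas p(3)] by auto
    moreover have "p \<in> states (machine Z' k)" using st k p by auto
    moreover from this have "p \<in> all_states Z'" using k by (auto simp: in_all_states)
    ultimately show ?thesis using ch p k by (auto simp: tree_arcs_iff)
  qed
  have rootn: "root_node Z \<in> nodes Z'"
  proof -
    have "False" if r: "child Z q = Some r" "(r, root_node Z) \<in> (tree_arcs Z)\<^sup>*" for r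
      using r(2)
    proof (cases rule: rtranclE)
      case base
      then show False using H(9)[of q] r f(1,2) by (auto simp: in_all_states)
    next
      case (step l)
      then show False using tree_arc_not_root[OF Z] by metis
    qed
    then show ?thesis using H(2) f(4) by auto
  qed
  \<comment> \<open>Transitions into \<open>q\<close> have become undefined and \<open>q\<close> is
    not the start state, so nothing refers to the removed state.\<close>
  have mm: "is_mm (machine Z' m)"
    using H(3)[OF f(1)] f(3,7-) by (auto simp: is_mm_def split: if_splits)
  have reach: "n \<in> nodes Z' \<Longrightarrow> (root_node Z, n) \<in> (tree_arcs Z')\<^sup>*"
    if "(root_node Z, n) \<in> (tree_arcs Z)\<^sup>*" for n
    using that
  proof (induction rule: rtrancl_induct)
    case (step k n)
    then have k: "k \<in> nodes Z'"
      using f(4) tree_arc_nodes[OF Z] by (auto intro: rtrancl_into_rtrancl)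
    obtain p where p: "p \<in> states (machine Z k)" "child Z p = Some n"
      using step(2) by (auto simp: tree_arcs_iff)
    then have "p \<noteq> q" using step(4) f(4) by auto
    then have "(k, n) \<in> tree_arcs Z'" using par k p by auto
    then show ?case using step(3)[OF k] by simp
  qed simp
  show ?thesis
  proof (rule is_himmI[where S = "Sigma_of Z" and L = "Lambda_of Z"])
    show "finite (nodes Z')" "root_node Z' \<in> nodes Z'" "Lambda_of Z \<subseteq> {0..}"
      using H rootn f(5) subn finite_subset by auto
    fix n assume n: "n \<in> nodes Z'"
    show "is_mm (machine Z' n)" "inputs (machine Z' n) = Sigma_of Z"
      "outputs (machine Z' n) = Lambda_of Z"
      using n H(3-5)[of n] mach[of n] mm f(8,9) subn by (cases "n = m"; auto)+
    show "(root_node Z', n) \<in> (tree_arcs Z')\<^sup>*"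
      using reach n H(11) f(5) subn by auto
  next
    fix k n p
    assume "k \<in> nodes Z'" "n \<in> nodes Z'" "p \<in> states (machine Z' k)" "p \<in> states (machine Z' n)"
    then show "k = n" using H(7)[of k n p] st subn by auto
  next
    fix p n assume p: "p \<in> all_states Z'" "child Z' p = Some n"
    then obtain k where "k \<in> nodes Z'" "p \<in> states (machine Z k)"
      using st by (auto simp: in_all_states)
    then show "n \<in> nodes Z' \<and> n \<noteq> root_node Z'"
      using par[of k p n] p as[OF p(1)] ch[OF p(1)] H(9)[of p] f(5) by auto
  next
    fix p p' n
    assume "p \<in> all_states Z'" "child Z' p = Some n" "p' \<in> all_states Z'" "child Z' p' = Some n"
    then show "p = p'" using H(10)[of p n p'] as ch by auto
  qed
qed

text \<open>The machines \<open>Zs ! i\<close> are grafted onto the single machine \<open>A\<close> one after another.\<close>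

lemma is_himm_composition:
  assumes c: "composition m A qs Zs Z'" and Zs: "\<And>Y. Y \<in> set Zs \<Longrightarrow> is_himm Y"
  shows "is_himm Z'"
proof -
  have f: "is_mm A" "outputs A \<subseteq> {0..}" "distinct qs" "set qs = states A"
    "length Zs \<le> length qs"
    "nodes Z' = insert m (\<Union>Y\<in>set Zs. nodes Y)" "root_node Z' = m" "machine Z' m = A"
    using c by (auto simp: composition_def)
  have g: "Sigma_of (Zs ! i) = inputs A" "Lambda_of (Zs ! i) = outputs A"
    "m \<notin> nodes (Zs ! i)" "states A \<inter> all_states (Zs ! i) = {}"
    "same_on (nodes (Zs ! i)) (all_states (Zs ! i)) (Zs ! i) Z'"
    if "i < length Zs" for i
    using c that by (auto simp: composition_def)
  have comp: "compatible (Zs ! j) (Zs ! i)" if "j < i" "i < length Zs" for i j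
    using c that by (auto simp: composition_def)
  have chq: "child Z' (qs ! i) = (if i < length Zs then Some (root_node (Zs ! i)) else None)"
    if "i < length qs" for i
    using c that by (auto simp: composition_def)
  \<comment> \<open>In \<open>W k\<close> the first \<open>k\<close> HiMMs are attached and every
    later state of \<open>A\<close> is terminal. It is cut out of \<open>Z'\<close>, so that only
    \<open>nodes\<close> and \<open>child\<close> vary with \<open>k\<close>.\<close>
  define W where "W k = Z'\<lparr>nodes := insert m (\<Union>i<k. nodes (Zs ! i)),
      child := (\<lambda>p. if p \<in> (!) qs ` {k..<length qs} then None else child Z' p)\<rparr>" for k
  have asW: "all_states (W k) = states A \<union> (\<Union>i<k. all_states (Zs ! i))"
    if "k \<le> length Zs" for k
  proof -
    have "states (machine Z' n) = states (machine (Zs ! i) n)" if "i < k" "n \<in> nodes (Zs ! i)" for i n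
      using g(5)[of i] that \<open>k \<le> length Zs\<close> by (auto simp: same_on_def)
    then show ?thesis using f(8) by (auto simp: in_all_states W_def)
  qed
  have W: "is_himm (W k)" if "k \<le> length Zs" for k
    using that
  proof (induction k)
    case 0
    have "child (W 0) p = None" if "p \<in> states A" for p
    proof -
      obtain i where "i < length qs" "qs ! i = p"
        using \<open>p \<in> states A\<close> f(4) by (metis in_set_conv_nth)
      then show ?thesis by (auto simp: W_def)
    qed
    then show ?case
      using asW[of 0]
      by (intro is_himmI[where S = "inputs A" and L = "outputs A"])
        (use f in \<open>auto simp: W_def\<close>)
  next
    case (Suc k)
    then have k: "k < length Zs" "k < length qs" and IH: "is_himm (W k)"
      using f(5) by auto
    have q: "qs ! k \<in> terminal_states (W k)"
      using k f(4) asW[of k] by (auto simp: terminal_states_def W_def)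
    have S: "Sigma_of (W k) = inputs A" "Lambda_of (W k) = outputs A"
      using f by (auto simp: W_def Sigma_of_def Lambda_of_def)
    have "compatible (Zs ! i) (Zs ! k)" if "i < k" for i
      using comp that k by auto
    then have "compatible (Zs ! k) (W k)"
      unfolding compatible_def S asW[OF less_imp_le[OF k(1)]]
      using g(1-4)[OF k(1)] by (auto simp: W_def compatible_def)
    moreover have "nodes (W (Suc k)) = nodes (W k) \<union> nodes (Zs ! k)"
      "root_node (W (Suc k)) = root_node (W k)"
      by (auto simp: W_def lessThan_Suc)
    moreover have "same_on (nodes (W k)) (all_states (W k) - {qs ! k}) (W k) (W (Suc k))"
    proof -
      have "{k..<length qs} = insert k {Suc k..<length qs}" using k(2) by auto
      then show ?thesis by (auto simp: same_on_def W_def)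
    qed
    moreover have "same_on (nodes (Zs ! k)) (all_states (Zs ! k)) (Zs ! k) (W (Suc k))"
    proof -
      have "p \<notin> (!) qs ` {Suc k..<length qs}" if "p \<in> all_states (Zs ! k)" for p
        using g(4)[OF k(1)] that f(4) by (metis (no_types, lifting) atLeastLessThan_iff
            disjoint_iff imageE nth_mem)
      then show ?thesis using g(5)[OF k(1)] by (auto simp: same_on_def W_def)
    qed
    moreover have "child (W (Suc k)) (qs ! k) = Some (root_node (Zs ! k))"
    proof -
      have "qs ! k \<notin> (!) qs ` {Suc k..<length qs}"
        using k(2) f(3) by (auto simp: nth_eq_iff_index_eq)
      then show ?thesis using chq[OF k(2)] k(1) by (auto simp: W_def)
    qed
    ultimately show ?case
      using is_himm_graft[OF IH Zs[OF nth_mem[OF k(1)]] _ q] by blast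
  qed
  have "(\<Union>i<length Zs. nodes (Zs ! i)) = (\<Union>Y\<in>set Zs. nodes Y)"
    by (force simp: in_set_conv_nth)
  then have "nodes (W (length Zs)) = nodes Z'" using f(6) by (simp add: W_def)
  \<comment> \<open>The states of \<open>A\<close> beyond the first \<open>length Zs\<close> are
    terminal in \<open>Z'\<close> already, so overriding \<open>child\<close> by \<open>None\<close>
    there changes nothing.\<close>
  moreover have "child (W (length Zs)) = child Z'"
    using chq by (auto simp: W_def fun_eq_iff)
  ultimately have "W (length Zs) = Z'"
    by (intro himm.equality) (auto simp: W_def)
  then show ?thesis using W[of "length Zs"] by simp
qed

lemma is_himm_yields:
  assumes "yields md Z" "\<forall>Y\<in>given_himms md. is_himm Y"
  shows "is_himm Z"
proof (cases md)
  case (State_Addition Z0 m q Zadd)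
  then show ?thesis using assms by (auto intro: is_himm_state_addition)
next
  case (State_Subtraction Z0 m q)
  then show ?thesis using assms by (auto intro: is_himm_state_subtraction)
next
  case (Arc_Modification Z0 m)
  then show ?thesis
    using assms is_himm_replace_machine[of Z0 m Z]
    by (auto simp: arc_modification_def Let_def)
next
  case (Composition m A qs Zs)
  then show ?thesis using assms by (auto intro: is_himm_composition)
qed


lemma modified_node_in_nodes:
  assumes "yields md Z" "\<forall>Y\<in>given_himms md. is_himm Y"
  shows "modified_node md \<in> nodes Z"
  using assms
  by (cases md)
    (auto simp: state_addition_def arc_modification_def composition_def
      intro: state_subtraction_modified_node split: option.splits)

text \<open>Every other machine comes from a given HiMM, hence is unmarked and has stored values if
  these HiMMs are up to date. This settles both the initial number of marks and whether a run can
  get stuck.\<close>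

lemma nodes_of_modified:
  assumes "yields md Z" "n \<in> nodes Z"
  shows "n = modified_node md \<or> (\<exists>Y\<in>given_himms md. n \<in> nodes Y)"
  using assms
  by (cases md)
    (auto simp: state_addition_def state_subtraction_def arc_modification_def composition_def
      split: option.splits)


section \<open>Ancestors and depth\<close>

lemma finite_tree_arcs:
  assumes "is_himm Z"
  shows "finite (tree_arcs Z)"
proof (rule finite_subset)
  show "tree_arcs Z \<subseteq> nodes Z \<times> nodes Z" using tree_arc_nodes[OF assms] by auto
qed (use is_himmD(1)[OF assms] in auto)

lemma wf_tree_arcs_converse:
  assumes "is_himm Z"
  shows "wf ((tree_arcs Z)\<inverse>)"
  using finite_acyclic_wf_converse finite_tree_arcs acyclic_tree_arcs assms by blast

text \<open>\<open>depth\<close> is a maximum, which bounds its elements only if the set is finite.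
  A longer path is one state followed by a path from the child it leads to, and the branching is
  finite, so induction from the leaves upwards applies.\<close>

lemma finite_arc_paths:
  assumes Z: "is_himm Z"
  shows "n \<in> nodes Z \<Longrightarrow> finite {qs. arc_path Z n qs}"
proof (induction n rule: wf_induct_rule[OF wf_tree_arcs_converse[OF Z]])
  case (1 n)
  let ?S = "states (machine Z n)"
  let ?N = "{n'. (n, n') \<in> tree_arcs Z}"
  have "{qs. arc_path Z n qs} \<subseteq>
      insert [] ((\<lambda>q. [q]) ` ?S) \<union> (\<Union>q\<in>?S. \<Union>n'\<in>?N. (#) q ` {qs. arc_path Z n' qs})"
  proof
    fix qs assume "qs \<in> {qs. arc_path Z n qs}"
    then show "qs \<in> insert [] ((\<lambda>q. [q]) ` ?S) \<union>
        (\<Union>q\<in>?S. \<Union>n'\<in>?N. (#) q ` {qs. arc_path Z n' qs})"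
      using 1(2) by (cases qs) (auto simp: tree_arcs_iff)
  qed
  moreover have "finite ?S" using is_himmD(3)[OF Z 1(2)] by (simp add: is_mm_def)
  moreover have "finite ?N"
    by (rule finite_subset[OF _ is_himmD(1)[OF Z]]) (use tree_arc_nodes[OF Z] in auto)
  moreover have "finite {qs. arc_path Z n' qs}" if "n' \<in> ?N" for n'
    using that 1(1) tree_arc_nodes[OF Z] by auto
  ultimately show ?case by (auto intro: finite_subset)
qed

lemma arc_path_length_le_depth:
  assumes "is_himm Z" "arc_path Z (root_node Z) qs"
  shows "length qs \<le> depth Z"
  unfolding depth_def
  using assms finite_arc_paths[OF assms(1) is_himmD(2)[OF assms(1)]] by (intro Max_ge) auto

text \<open>The ancestors of a node form a chain, because arcs into a node have a unique source.\<close>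

lemma ancestors_le_depth:
  assumes Z: "is_himm Z" and n: "n \<in> nodes Z"
  shows "card {a. (a, n) \<in> (tree_arcs Z)\<^sup>*} \<le> depth Z"
    and "{a. (a, n) \<in> (tree_arcs Z)\<^sup>*} \<subseteq> nodes Z"
proof -
  let ?A = "\<lambda>n. {a. (a, n) \<in> (tree_arcs Z)\<^sup>*}"
  show sub: "?A n \<subseteq> nodes Z"
    using n tree_arc_nodes[OF Z] by (auto elim: converse_rtranclE)
  \<comment> \<open>Stated for every nonempty path \<open>ps\<close> from \<open>n\<close>, so that
    the inductive step can prepend the arc from the parent. The path from the root gains one arc for
    each proper ancestor, whence the \<open>+ 1\<close>.\<close>
  have "finite (?A n) \<and> (\<forall>ps. arc_path Z n ps \<and> ps \<noteq> [] \<longrightarrow>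
      (\<exists>qs. arc_path Z (root_node Z) qs \<and> length qs + 1 = card (?A n) + length ps))"
    using is_himmD(11)[OF Z n]
  proof (induction rule: rtrancl_induct)
    case base
    have "?A (root_node Z) = {root_node Z}"
      using tree_arc_not_root[OF Z] by (auto elim: rtranclE)
    then show ?case by auto
  next
    case (step k n)
    have "a = n \<or> (a, k) \<in> (tree_arcs Z)\<^sup>*" if "(a, n) \<in> (tree_arcs Z)\<^sup>*" for a
      using that
    proof (cases rule: rtranclE)
      case (step l)
      then show ?thesis using tree_arc_unique_source[OF Z step(2) \<open>(k, n) \<in> tree_arcs Z\<close>] by simp
    qed simp
    then have "?A n = insert n (?A k)"
      using step(2) by (auto intro: rtrancl_into_rtrancl)
    moreover have "n \<notin> ?A k"
      using step(2) acyclic_tree_arcs[OF Z] by (auto simp: acyclic_def intro: rtrancl_into_trancl1)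
    ultimately have A: "finite (?A n)" "card (?A n) = Suc (card (?A k))"
      using step(3) by auto
    obtain q where q: "q \<in> states (machine Z k)" "child Z q = Some n"
      using step(2) by (auto simp: tree_arcs_iff)
    have "\<exists>qs. arc_path Z (root_node Z) qs \<and> length qs + 1 = card (?A n) + length ps"
      if "arc_path Z n ps" for ps
    proof -
      have "arc_path Z k (q # ps)" using that q by simp
      then have "\<exists>qs. arc_path Z (root_node Z) qs \<and> length qs + 1 = card (?A k) + length (q # ps)"
        using step(3) by blast
      then show ?thesis using A(2) by simp
    qed
    then show ?case using A(1) by blast
  qed
  \<comment> \<open>One more arc leaves \<open>n\<close>, terminal or not. It makes up for the arc
    that a chain of nodes lacks, so the number of ancestors equals the length of a path from the
    root.\<close>
  moreover have "arc_path Z n [start (machine Z n)]"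
    using is_himmD(3)[OF Z n] by (simp add: is_mm_def)
  ultimately obtain qs where "arc_path Z (root_node Z) qs"
    "length qs + 1 = card (?A n) + length [start (machine Z n)]"
    by blast
  then show "card (?A n) \<le> depth Z"
    using arc_path_length_le_depth[OF Z, of qs] by simp
qed

text \<open>Needed for compositions, whose single mark must also be covered by the depth.\<close>

lemma depth_pos:
  assumes "is_himm Z"
  shows "1 \<le> depth Z"
proof -
  have "arc_path Z (root_node Z) [start (machine Z (root_node Z))]"
    using is_himmD(2,3)[OF assms] by (simp add: is_mm_def)
  then show ?thesis using arc_path_length_le_depth[OF assms] by fastforce
qed

lemma card_states_le_max_states:
  assumes "is_himm Z" "n \<in> nodes Z"
  shows "card (states (machine Z n)) \<le> max_states Z"
  unfolding max_states_def using assms is_himmD(1)[OF assms(1)] by (intro Max_ge) auto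

lemma card_states_pos: "is_mm A \<Longrightarrow> 1 \<le> card (states A)"
  by (auto simp: is_mm_def Suc_le_eq card_gt_0_iff)


section \<open>The cost of a single machine\<close>

lemma tree_path_unique:
  assumes "tree_path p s v w" "tree_path p s v w'"
  shows "w = w'"
  using assms
proof (induction arbitrary: w' rule: tree_path.induct)
  case 1
  then show ?case by cases auto
next
  case step: (2 v u y w)
  from step(5) show ?case
  proof cases
    case 1
    then show ?thesis using step(1) by simp
  next
    case (2 u' y' w'')
    then have "u' = u" "y' = y" using \<open>p v = Some (u, y)\<close> by auto
    then show ?thesis using step.IH 2 by blast
  qed
qed

text \<open>The witness is the initial part of \<open>w\<close> up to a place where it leaves
  \<open>u\<close>.\<close>

lemma tree_path_through:
  assumes "tree_path p s v w" "u \<in> fst ` set w"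
  shows "\<exists>w'. tree_path p s u w' \<and> length w' < length w"
  using assms
proof (induction rule: tree_path.induct)
  case (2 v u' y w)
  show ?case
  proof (cases "u \<in> fst ` set w")
    case True
    then obtain w' where "tree_path p s u w'" "length w' < length w" using 2(4) by blast
    then show ?thesis by (intro exI[of _ w']) simp
  next
    case False
    then have "u = u'" using 2(5) by auto
    then show ?thesis using 2(3) by auto
  qed
qed simp

text \<open>If the last vertex \<open>u\<close> had been left before, it would have a tree path
  shorter than \<open>w\<close>, which is its only one.\<close>

lemma tree_path_distinct:
  assumes "tree_path p s v w"
  shows "distinct (map fst w)"
  using assms
proof (induction rule: tree_path.induct)
  case (2 v u y w)
  have "u \<notin> fst ` set w"
  proof
    assume "u \<in> fst ` set w"
    then obtain w' where "tree_path p s u w'" "length w' < length w"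
      using tree_path_through[OF 2(3)] by blast
    then show False using tree_path_unique[OF 2(3)] by blast
  qed
  then show ?case using 2(4) by auto
qed simp

text \<open>The second conjunct serves to keep exit states out: they have no outgoing transitions,
  so a walk in an augmented machine leaves only states of the original one.\<close>

lemma walk_vertices:
  assumes "walk A u w v" "q \<in> fst ` set w"
  shows "q \<in> states A \<and> (\<exists>y. delta A q y \<noteq> None)"
  using assms
proof (induction w arbitrary: u)
  case (Cons a w)
  obtain p y where a: "a = (p, y)" by fastforce
  then obtain u' where u': "u \<in> states A" "p = u" "delta A u y = Some u'" "walk A u' w v"
    using Cons.prems(1) by auto
  show ?case
  proof (cases "q = u")
    case True
    then show ?thesis using u' by blast
  next
    case False
    then show ?thesis using Cons.IH[OF u'(4)] Cons.prems(2) a u'(2) by simp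
  qed
qed simp

section \<open>Size and cost of an augmented machine\<close>

lemma is_mm_augment:
  assumes "is_mm A"
  shows "is_mm (augment A e)"
proof -
  have "v \<in> St ` states A \<union> Exit ` inputs A"
    if "a \<in> St ` states A \<union> Exit ` inputs A" "x \<in> inputs A" "aug_delta A a x = Some v" for a x v
    using that assms by (auto simp: is_mm_def split: option.splits)
  then show ?thesis using assms by (auto simp: is_mm_def augment_def Let_def)
qed

lemma read_time_le:
  assumes A: "is_mm A" and r: "shortest_paths (augment A e) r"
  shows "read_time (inputs A) (read_exits A r) \<le> card (inputs A) * (1 + card (states A))"
proof -
  have "(case snd (read_exits A r x) of None \<Rightarrow> 0 | Some w \<Rightarrow> length w) \<le> card (states A)"
    if x: "x \<in> inputs A" for x
  proof (cases "dist_to r (Exit x) = \<infinity>")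
    case False
    have "Exit x \<in> states (augment A e)" using x by (simp add: augment_def Let_def)
    moreover have "start (augment A e) = St (start A)" by (simp add: augment_def Let_def)
    ultimately obtain w where w: "tree_path (pred_arc r) (St (start A)) (Exit x) w"
      "walk (augment A e) (St (start A)) w (Exit x)"
      using r False unfolding shortest_paths_def by (metis infinity_ennreal_def top.not_eq_extremum)
    \<comment> \<open>Dijkstra's algorithm promises some optimal tree path; uniqueness makes it the
      one that \<open>read_exits\<close> selects.\<close>
    then have "(THE w. tree_path (pred_arc r) (St (start A)) (Exit x) w) = w"
      by (blast intro: tree_path_unique)
    then have "snd (read_exits A r x) = Some w"
      using False by (simp add: read_exits_def)
    \<comment> \<open>Each arc of the path is counted by the vertex it leaves, and these are
      distinct states of \<open>A\<close>.\<close>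
    moreover have "fst ` set w \<subseteq> St ` states A"
      using walk_vertices[OF w(2)] by (fastforce simp: augment_def Let_def)
    then have "card (fst ` set w) \<le> card (states A)"
      using A by (meson card_image_le card_mono finite_imageI is_mm_def order_trans)
    then have "length w \<le> card (states A)"
      using distinct_card[OF tree_path_distinct[OF w(1)]] by simp
    ultimately show ?thesis by simp
  qed (simp add: read_exits_def)
  then have "read_time (inputs A) (read_exits A r) \<le> (\<Sum>x\<in>inputs A. 1 + card (states A))"
    unfolding read_time_def by (intro sum_mono add_mono) auto
  then show ?thesis by simp
qed

lemma augment_time_le:
  assumes "is_mm A"
  shows "augment_time A \<le>
    card (states A) + card (inputs A) + 4 * (card (states A) * card (inputs A))"
proof -
  have "(\<Sum>q\<in>states A. \<Sum>y\<in>inputs A. if delta A q y \<noteq> None then 4 else 3) \<le>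
      (\<Sum>q\<in>states A. \<Sum>y\<in>inputs A. (4::nat))"
    by (intro sum_mono) auto
  then show ?thesis by (simp add: augment_time_def)
qed

lemma num_arcs_augment:
  assumes "is_mm A"
  shows "num_arcs (augment A e) \<le> card (states A) * card (inputs A)"
proof -
  have "{(v, y). v \<in> states (augment A e) \<and> y \<in> inputs (augment A e) \<and>
      delta (augment A e) v y \<noteq> None} \<subseteq> (\<lambda>(q, y). (St q, y)) ` (states A \<times> inputs A)"
    by (auto simp: augment_def Let_def)
  then have "num_arcs (augment A e) \<le>
      card ((\<lambda>(q, y). (St q :: ('a, 'b) aug_state, y)) ` (states A \<times> inputs A))"
    using assms unfolding num_arcs_def by (intro card_mono) (auto simp: is_mm_def)
  also have "\<dots> \<le> card (states A \<times> inputs A)"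
    using assms by (intro card_image_le) (auto simp: is_mm_def)
  finally show ?thesis by (simp add: card_cartesian_product)
qed

lemma num_vertices_augment:
  assumes "is_mm A"
  shows "num_vertices (augment A e) = card (states A) + card (inputs A)"
proof -
  have "card (St ` states A \<union> Exit ` inputs A) =
      card (St ` states A :: ('a, 'b) aug_state set) + card (Exit ` inputs A :: ('a, 'b) aug_state set)"
    using assms by (intro card_Un_disjoint) (auto simp: is_mm_def)
  then show ?thesis by (simp add: num_vertices_def augment_def Let_def card_image inj_on_def)
qed

text \<open>
  Accounts for one call at a marked machine together with the operations that its calls for
  unmarked children and terminal states take.
\<close>

definition call_time ::
  "((('q, 'x) aug_state, 'x, ennreal) mm \<Rightarrow> (('q, 'x) aug_state, 'x) sp_result \<times> nat)
   \<Rightarrow> ('q, 'x, real) mm \<Rightarrow> ('q \<Rightarrow> ('q, 'x) exit_values) \<Rightarrow> nat" where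
  "call_time D A e =
     2 + 3 * card (inputs A) + card (states A) * (2 + 2 * card (inputs A)) + augment_time A +
     snd (D (augment A e)) +
     read_time (inputs A) (read_exits A (fst (D (augment A e))))"

text \<open>The factor 7 is the coefficient of the number of state-input pairs: 2 from passing up
  the values of children, 4 from the new transitions and their costs, 1 from reading off paths. The
  smaller coefficients of the lower terms are rounded up to it. The summand \<open>K\<close> pays
  for Dijkstra's algorithm.\<close>

lemma call_time_le:
  assumes D: "\<And>A. is_mm A \<Longrightarrow> shortest_paths A (fst (D A))"
    and K: "0 \<le> K" "\<And>A. is_mm A \<Longrightarrow> real (snd (D A)) \<le>
      K * (real (num_arcs A) + real (num_vertices A) * log 2 (real (num_vertices A)) + 1)"
    and Z: "is_himm Z" "n \<in> nodes Z"
  shows "real (call_time D (machine Z n) e) \<le>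
    (7 + K) * (layer_bound Z + real (max_states Z + card (Sigma_of Z)) + 1)"
proof -
  define A where "A = machine Z n"
  define k s b where "k = card (states A)" and "s = card (Sigma_of Z)" and "b = max_states Z"
  define g where "g = layer_bound Z"
  have A: "is_mm A" and inp: "inputs A = Sigma_of Z"
    using is_himmD(3,4)[OF Z(1) Z(2)] by (auto simp: A_def)
  have k: "1 \<le> k" "k \<le> b"
    using card_states_pos[OF A] card_states_le_max_states[OF Z] by (auto simp: k_def b_def A_def)
  have aug: "is_mm (augment A e)" by (rule is_mm_augment[OF A])
  \<comment> \<open>\<open>1 \<le> k\<close> makes the logarithm on the left nonnegative, which
    monotonicity of the product needs.\<close>
  have lg: "real (k + s) * log 2 (real (k + s)) \<le> real (b + s) * log 2 (real (b + s))"
    using k by (intro mult_mono) auto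
  have ks: "k * s \<le> b * s" using k by simp
  then have arcs: "real (num_arcs (augment A e)) \<le> real (b * s)"
    using num_arcs_augment[OF A, of e] unfolding k_def s_def inp
    by (intro of_nat_mono) (rule order_trans)
  have g: "g = real (b * s) + real (b + s) * log 2 (real (b + s))"
    by (simp add: g_def layer_bound_def b_def s_def Let_def)
  have lg0: "0 \<le> real (b + s) * log 2 (real (b + s))" using k by simp
  have "real (snd (D (augment A e))) \<le>
      K * (real (num_arcs (augment A e)) + real (k + s) * log 2 (real (k + s)) + 1)"
    using K(2)[OF aug] num_vertices_augment[OF A, of e] by (simp add: k_def s_def inp)
  also have "\<dots> \<le> K * (g + 1)"
    using arcs lg K(1) unfolding g by (intro mult_left_mono add_mono) auto
  also have "\<dots> \<le> K * (g + real (b + s) + 1)" using K(1) by (intro mult_left_mono) auto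
  finally have d: "real (snd (D (augment A e))) \<le> K * (g + real (b + s) + 1)" .
  have "call_time D A e \<le> 2 + 3 * s + k * (2 + 2 * s) + (k + s + 4 * (k * s)) +
      snd (D (augment A e)) + s * (1 + k)"
    using augment_time_le[OF A] read_time_le[OF A D[OF aug]]
    by (simp add: call_time_def k_def s_def inp algebra_simps)
  also have "\<dots> \<le> 7 * (b * s) + 7 * (b + s) + 7 + snd (D (augment A e))"
    proof -
    \<comment> \<open>\<open>p\<close> and \<open>q\<close> abstract the products
      \<open>k * s\<close> and \<open>b * s\<close>, which leaves a linear inequality.\<close>
    have "2 + 3 * s + (2 * k + 2 * p) + (k + s + 4 * p) + d + (s + p) \<le> 7 * q + 7 * (b + s) + 7 + d"
      if "p \<le> q" for p q d
      using that k(2) by simp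
    from this[OF ks] show ?thesis by (simp add: algebra_simps)
  qed
  finally have "call_time D A e \<le> 7 * (b * s) + 7 * (b + s) + 7 + snd (D (augment A e))" .
  then have "real (call_time D A e) \<le>
      7 * real (b * s) + 7 * real (b + s) + 7 + real (snd (D (augment A e)))"
    by linarith
  also have "\<dots> \<le> 7 * (g + real (b + s) + 1) + K * (g + real (b + s) + 1)"
  proof -
    have "real (b * s) \<le> g" using lg0 by (simp add: g)
    then show ?thesis using d by simp
  qed
  finally show ?thesis by (simp add: A_def g_def b_def s_def algebra_simps)
qed


section \<open>Runs of the Optimal Exit Computer\<close>

definition num_marked :: "('n, 'q, 'x) himm \<Rightarrow> ('n, 'q, 'x) memory \<Rightarrow> nat" where
  "num_marked Z \<mu> = card {n \<in> nodes Z. marked \<mu> n}"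

text \<open>
  Every computing call pays for itself by unmarking its machine, so the number of marks serves as
  a potential. That calls only touch descendants ensures that the mark of \<open>m\<close> is still
  present when the calls for its children have returned.
\<close>

lemma optimal_exit_potential:
  fixes \<mu> \<mu>' :: "('n, 'q, 'x) memory" and L :: real
  assumes Z: "is_himm Z"
    and L: "\<And>n e. n \<in> nodes Z \<Longrightarrow> real (call_time D (machine Z n) e) \<le> L"
  shows "optimal_exit D Z \<mu> m r \<mu>' t \<Longrightarrow> m \<in> nodes Z \<longrightarrow>
      (\<forall>n. marked \<mu>' n \<noteq> marked \<mu> n \<longrightarrow> (m, n) \<in> (tree_arcs Z)\<^sup>*) \<and>
      real t + L * num_marked Z \<mu>' \<le> 1 + card (Sigma_of Z) + L * num_marked Z \<mu>"
    and "child_exits D Z \<mu> qs e \<mu>' t \<Longrightarrow>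
      \<forall>m\<in>nodes Z. set qs \<subseteq> states (machine Z m) \<longrightarrow>
      (\<forall>n. marked \<mu>' n \<noteq> marked \<mu> n \<longrightarrow> (m, n) \<in> (tree_arcs Z)\<^sup>+) \<and>
      real t + L * num_marked Z \<mu>' \<le>
        length qs * (2 + 2 * card (Sigma_of Z)) + L * num_marked Z \<mu>"
proof (induction rule: optimal_exit_child_exits.inducts)
  case (compute \<mu> m qs e \<mu>1 t1 res t2 r \<mu>' t)
  show ?case
  proof (intro impI conjI allI)
    assume m: "m \<in> nodes Z"
    have IH: "\<And>n. marked \<mu>1 n \<noteq> marked \<mu> n \<Longrightarrow> (m, n) \<in> (tree_arcs Z)\<^sup>+"
      "real t1 + L * num_marked Z \<mu>1 \<le>
        length qs * (2 + 2 * card (Sigma_of Z)) + L * num_marked Z \<mu>"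
      using compute(6) m compute(4) by auto
    show "(m, n) \<in> (tree_arcs Z)\<^sup>*" if "marked \<mu>' n \<noteq> marked \<mu> n" for n
      using that IH(1)[of n] compute(3) by (cases "n = m") (auto intro: trancl_into_rtrancl)
    \<comment> \<open>A change of this mark during the calls for the children would make
      \<open>m\<close> a proper descendant of itself.\<close>
    have m1: "marked \<mu>1 m"
      using IH(1)[of m] compute(1) acyclic_tree_arcs[OF Z] by (auto simp: acyclic_def)
    have "{n \<in> nodes Z. marked \<mu>1 n} = insert m {n \<in> nodes Z. marked \<mu>' n}"
      using m m1 compute(3) by auto
    moreover have "m \<notin> {n \<in> nodes Z. marked \<mu>' n}" using compute(3) by simp
    ultimately have P: "num_marked Z \<mu>1 = Suc (num_marked Z \<mu>')"
      using is_himmD(1)[OF Z] by (simp add: num_marked_def)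
    have inp: "inputs (machine Z m) = Sigma_of Z" using is_himmD(4)[OF Z m] .
    have "length qs = card (states (machine Z m))"
      using compute(2,4) by (metis distinct_card)
    \<comment> \<open>The allowance of \<open>2 + 2 * card (Sigma_of Z)\<close> per state in the
      induction hypothesis is also a summand of \<open>call_time\<close>, so the one mark removed
      here pays for it too.\<close>
    then have "t + length qs * (2 + 2 * card (Sigma_of Z)) + 1 + card (Sigma_of Z) =
        1 + card (Sigma_of Z) + t1 + call_time D (machine Z m) e"
      using compute(7,8,9) inp by (simp add: call_time_def)
    then have "real t + length qs * (2 + 2 * card (Sigma_of Z)) \<le> t1 + L"
      using L[OF m, of e] by linarith
    then show "real t + L * num_marked Z \<mu>' \<le> 1 + card (Sigma_of Z) + L * num_marked Z \<mu>"
      using IH(2) P by (simp add: algebra_simps)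
  qed
next
  case (terminal_state q \<mu> qs e \<mu>' t)
  show ?case
  proof (intro ballI impI)
    fix m assume m: "m \<in> nodes Z" and "set (q # qs) \<subseteq> states (machine Z m)"
    then show "(\<forall>n. marked \<mu>' n \<noteq> marked \<mu> n \<longrightarrow> (m, n) \<in> (tree_arcs Z)\<^sup>+) \<and>
      real (1 + card (Sigma_of Z) + t) + L * num_marked Z \<mu>' \<le>
        length (q # qs) * (2 + 2 * card (Sigma_of Z)) + L * num_marked Z \<mu>"
      using terminal_state(3) by (auto simp: algebra_simps)
  qed
next
  case (refined_state q n \<mu> r \<mu>1 t1 qs e \<mu>2 t2)
  show ?case
  proof (intro ballI impI)
    fix m assume m: "m \<in> nodes Z" and qs: "set (q # qs) \<subseteq> states (machine Z m)"
    have arc: "(m, n) \<in> tree_arcs Z" using m qs refined_state(1) by (auto simp: tree_arcs_iff)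
    have "n \<in> nodes Z" using tree_arc_nodes(2)[OF Z arc] .
    then have 1: "\<And>k. marked \<mu>1 k \<noteq> marked \<mu> k \<Longrightarrow> (m, k) \<in> (tree_arcs Z)\<^sup>+"
      "real t1 + L * num_marked Z \<mu>1 \<le> 1 + card (Sigma_of Z) + L * num_marked Z \<mu>"
      using refined_state(3) arc by (auto intro: rtrancl_into_trancl2)
    have 2: "\<And>k. marked \<mu>2 k \<noteq> marked \<mu>1 k \<Longrightarrow> (m, k) \<in> (tree_arcs Z)\<^sup>+"
      "real t2 + L * num_marked Z \<mu>2 \<le>
        length qs * (2 + 2 * card (Sigma_of Z)) + L * num_marked Z \<mu>1"
      using refined_state(5) m qs by auto
    have "(m, k) \<in> (tree_arcs Z)\<^sup>+" if "marked \<mu>2 k \<noteq> marked \<mu> k" for k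
      using that 1(1)[of k] 2(1)[of k] by auto
    \<comment> \<open>One half of the allowance for the state \<open>q\<close> covers what the call
      may cost beyond the marks it removes, the other half the visit of \<open>q\<close>
      itself.\<close>
    then show "(\<forall>k. marked \<mu>2 k \<noteq> marked \<mu> k \<longrightarrow> (m, k) \<in> (tree_arcs Z)\<^sup>+) \<and>
      real (1 + t1 + card (Sigma_of Z) + t2) + L * num_marked Z \<mu>2 \<le>
        length (q # qs) * (2 + 2 * card (Sigma_of Z)) + L * num_marked Z \<mu>"
      using 1(2) 2(2) by (simp add: algebra_simps)
  qed
qed simp_all

section \<open>Existence and cost of whole runs\<close>

definition usable :: "('n, 'q, 'x) memory \<Rightarrow> ('n, 'q, 'x) himm \<Rightarrow> bool" where
  "usable \<mu> Z \<longleftrightarrow> (\<forall>n\<in>nodes Z. marked \<mu> n \<or> stored \<mu> n \<noteq> None)"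

text \<open>A run gets stuck only at an unmarked machine without stored values.
  \<open>usable\<close> excludes this and is kept by every call, since it asks neither for correct
  values nor for the absence of marks. Each call hands its memory to the next one, so both
  inductions generalize the memory.\<close>

lemma optimal_exit_exists:
  fixes \<mu> :: "('n, 'q, 'x) memory"
  assumes Z: "is_himm Z"
  shows "m \<in> nodes Z \<Longrightarrow> usable \<mu> Z \<Longrightarrow> \<exists>r \<mu>' t. optimal_exit D Z \<mu> m r \<mu>' t \<and> usable \<mu>' Z"
proof (induction m arbitrary: \<mu> rule: wf_induct_rule[OF wf_tree_arcs_converse[OF Z]])
  case (1 m)
  show ?case
  proof (cases "marked \<mu> m")
    case False
    then obtain r where "stored \<mu> m = Some r" using 1(2,3) by (auto simp: usable_def)
    then show ?thesis using unmarked[of \<mu> m r D Z] False 1(3) by blast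
  next
    case True
    have "\<exists>e \<mu>' t. child_exits D Z \<mu> qs e \<mu>' t \<and> usable \<mu>' Z"
      if "set qs \<subseteq> states (machine Z m)" "usable \<mu> Z" for qs \<mu>
      using that
    proof (induction qs arbitrary: \<mu>)
      case Nil
      then show ?case using no_states by blast
    next
      case (Cons q qs)
      have qs: "set qs \<subseteq> states (machine Z m)" using Cons.prems(1) by simp
      show ?case
      proof (cases "child Z q")
        case None
        obtain e \<mu>' t where "child_exits D Z \<mu> qs e \<mu>' t" "usable \<mu>' Z"
          using Cons.IH[OF qs Cons.prems(2)] by blast
        then show ?thesis using terminal_state[OF None] by blast
      next
        case (Some n)
        then have arc: "(m, n) \<in> tree_arcs Z"
          using Cons.prems(1) 1(2) by (auto simp: tree_arcs_iff)
        then obtain r \<mu>1 t1 where r: "optimal_exit D Z \<mu> n r \<mu>1 t1" "usable \<mu>1 Z"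
          using 1(1)[of n \<mu>] tree_arc_nodes(2)[OF Z arc] Cons.prems(2) by auto
        obtain e \<mu>2 t2 where "child_exits D Z \<mu>1 qs e \<mu>2 t2" "usable \<mu>2 Z"
          using Cons.IH[OF qs r(2)] by blast
        then show ?thesis using refined_state[OF Some r(1)] by blast
      qed
    qed
    moreover obtain qs where qs: "distinct qs" "set qs = states (machine Z m)"
      using is_himmD(3)[OF Z 1(2)] by (metis finite_distinct_list is_mm_def)
    ultimately obtain e \<mu>1 t1 where e: "child_exits D Z \<mu> qs e \<mu>1 t1" "usable \<mu>1 Z"
      using 1(3) by blast
    obtain res t2 where D: "D (augment (machine Z m) e) = (res, t2)" by fastforce
    have "usable (\<mu>1\<lparr>marked := (marked \<mu>1)(m := False), stored := (stored \<mu>1)(m := Some r)\<rparr>) Z" for r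
      using e(2) by (simp add: usable_def)
    then show ?thesis using compute[OF True qs e(1) D refl refl refl] by blast
  qed
qed

lemma usable_mark:
  assumes "yields md Z" and "\<forall>Y\<in>given_himms md. up_to_date \<mu> Y"
  shows "usable (mark md Z \<mu>) Z"
proof -
  have "modified_node md \<in> nodes_to_mark md Z" by (simp add: nodes_to_mark_def)
  then show ?thesis
    unfolding usable_def
    using nodes_of_modified[OF assms(1)] assms(2) by (fastforce simp: mark_def up_to_date_def)
qed

text \<open>This is the potential at the start: the given HiMMs carry no marks, and the modified
  machine, which may belong to none of them, is marked in any case.\<close>

lemma num_marked_mark:
  assumes "yields md Z" and "\<forall>Y\<in>given_himms md. is_himm Y \<and> up_to_date \<mu> Y"
  shows "num_marked Z (mark md Z \<mu>) = card (nodes_to_mark md Z)"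
proof -
  have Z: "is_himm Z" and m: "modified_node md \<in> nodes Z"
    using is_himm_yields modified_node_in_nodes assms by blast+
  have m': "modified_node md \<in> nodes_to_mark md Z" by (simp add: nodes_to_mark_def)
  have "nodes_to_mark md Z \<subseteq> nodes Z"
    using m ancestors_le_depth(2)[OF Z m] by (simp add: nodes_to_mark_def)
  moreover have "\<not> marked \<mu> n" if "n \<in> nodes Z" "n \<notin> nodes_to_mark md Z" for n
    using nodes_of_modified[OF assms(1) that(1)] m' that assms(2) by (auto simp: up_to_date_def)
  ultimately have "{n \<in> nodes Z. marked (mark md Z \<mu>) n} = nodes_to_mark md Z"
    by (auto simp: mark_def)
  then show ?thesis by (simp add: num_marked_def)
qed

lemma card_nodes_to_mark:
  assumes "is_himm Z" and "modified_node md \<in> nodes Z"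
  shows "1 \<le> card (nodes_to_mark md Z)" and "card (nodes_to_mark md Z) \<le> depth Z"
    and "is_Composition md \<Longrightarrow> card (nodes_to_mark md Z) = 1"
proof -
  have "nodes_to_mark md Z \<subseteq> nodes Z"
    using assms(2) ancestors_le_depth(2)[OF assms] by (simp add: nodes_to_mark_def)
  then have "finite (nodes_to_mark md Z)"
    using is_himmD(1)[OF assms(1)] finite_subset by blast
  moreover have "modified_node md \<in> nodes_to_mark md Z" by (simp add: nodes_to_mark_def)
  ultimately show "1 \<le> card (nodes_to_mark md Z)"
    by (metis One_nat_def Suc_leI card_gt_0_iff empty_iff)
  show "card (nodes_to_mark md Z) \<le> depth Z"
    using ancestors_le_depth(1)[OF assms] depth_pos[OF assms(1)] by (simp add: nodes_to_mark_def)
  show "is_Composition md \<Longrightarrow> card (nodes_to_mark md Z) = 1"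
    by (simp add: nodes_to_mark_def)
qed

lemma runs_within_mono: "runs_within D md Z \<mu> a \<Longrightarrow> a \<le> b \<Longrightarrow> runs_within D md Z \<mu> b"
  unfolding runs_within_def by (meson order_trans)

text \<open>The bound uses the number of machines to mark, before the modifications are told apart,
  and the unabsorbed cost of a layer. The three claims then differ only in how these two factors are
  estimated.\<close>

lemma optimal_exit_computer_runs_within:
  fixes D :: "(('q, 'x) aug_state, 'x, ennreal) mm \<Rightarrow> (('q, 'x) aug_state, 'x) sp_result \<times> nat"
  assumes D: "dijkstra_fibonacci D"
  obtains K where "0 \<le> K"
    and "\<And>(md :: ('n, 'q, 'x) modification) Z \<mu>. \<lbrakk>yields md Z;
      \<forall>Y\<in>given_himms md. is_himm Y \<and> up_to_date \<mu> Y\<rbrakk> \<Longrightarrow>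
      runs_within D md Z \<mu> (K * (real (card (nodes_to_mark md Z)) *
        (layer_bound Z + real (max_states Z + card (Sigma_of Z)) + 1)))"
proof -
  have sp: "\<And>A. is_mm A \<Longrightarrow> shortest_paths A (fst (D A))"
    using D by (simp add: dijkstra_fibonacci_def)
  obtain K0 where K0: "\<And>A. is_mm A \<Longrightarrow> real (snd (D A)) \<le>
      K0 * (real (num_arcs A) + real (num_vertices A) * log 2 (real (num_vertices A)) + 1)"
    using D by (auto simp: dijkstra_fibonacci_def)
  \<comment> \<open>The constant in \<open>dijkstra_fibonacci\<close> may be negative. Enlarging it
    is harmless because the bracket is nonnegative: a machine has at least one vertex, so the
    logarithm is nonnegative.\<close>
  define K where "K = max K0 0"
  have K: "real (snd (D A)) \<le>
      K * (real (num_arcs A) + real (num_vertices A) * log 2 (real (num_vertices A)) + 1)"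
    if A: "is_mm A" for A
  proof -
    have "1 \<le> num_vertices A" using card_states_pos[OF A] by (simp add: num_vertices_def)
    then have "0 \<le> real (num_arcs A) + real (num_vertices A) * log 2 (real (num_vertices A)) + 1"
      by simp
    then show ?thesis using K0[OF A] by (smt (verit) K_def mult_right_mono)
  qed
  have "runs_within D md Z \<mu> (4 * (7 + K) * (real (card (nodes_to_mark md Z)) *
      (layer_bound Z + real (max_states Z + card (Sigma_of Z)) + 1)))"
    if y: "yields md Z" and g: "\<forall>Y\<in>given_himms md. is_himm Y \<and> up_to_date \<mu> Y"
    for md :: "('n, 'q, 'x) modification" and Z \<mu>
  proof -
    define P where "P = card (nodes_to_mark md Z)"
    define s where "s = card (Sigma_of Z)"
    define h where "h = layer_bound Z + real (max_states Z + s) + 1"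
    define L where "L = (7 + K) * h"
    have Z: "is_himm Z" and m: "modified_node md \<in> nodes Z"
      using is_himm_yields modified_node_in_nodes y g by blast+
    note root = is_himmD(2)[OF Z]
    have P: "1 \<le> P" using card_nodes_to_mark(1)[OF Z m] by (simp add: P_def)
    have "1 \<le> max_states Z"
      using card_states_pos[OF is_himmD(3)[OF Z root]] card_states_le_max_states[OF Z root] by simp
    then have "0 \<le> layer_bound Z" by (simp add: layer_bound_def Let_def)
    then have h: "1 + real s \<le> h" by (simp add: h_def)
    have Lh: "7 * h \<le> L" using h by (simp add: L_def K_def)
    have Lb: "real (call_time D (machine Z n) e) \<le> L" if "n \<in> nodes Z" for n e
      unfolding L_def h_def s_def
      by (rule call_time_le[OF sp _ K Z that]) (simp_all add: K_def)
    \<comment> \<open>Marking costs \<open>2 * P\<close> and the call at most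
      \<open>1 + s + L * P\<close>. As \<open>1 \<le> P\<close> and \<open>L\<close> is at least 2
      and at least \<open>1 + s\<close>, each of these three parts is at most
      \<open>P * L\<close>.\<close>
    have "real t \<le> 4 * (P * L)" if "optimal_exit_computer D md Z \<mu> t" for t
    proof -
      obtain r \<mu>' t' where t': "optimal_exit D Z (mark md Z \<mu>) (root_node Z) r \<mu>' t'"
        "t = 2 * P + t'"
        using \<open>optimal_exit_computer D md Z \<mu> t\<close>
        by (auto simp: optimal_exit_computer_def mark_time_def P_def)
      have "real t' + L * num_marked Z \<mu>' \<le> 1 + s + L * P"
        using optimal_exit_potential(1)[OF Z Lb t'(1)] root num_marked_mark[OF y g]
        by (simp add: P_def s_def)
      moreover have "0 \<le> L * num_marked Z \<mu>'" using Lh h by simp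
      moreover have "L \<le> P * L" using P Lh h by simp
      moreover have "real P * 2 \<le> P * L" using Lh h by (intro mult_left_mono) auto
      moreover have "1 + real s \<le> L" using Lh h by linarith
      moreover have "real t = 2 * real P + t'" using t'(2) by simp
      moreover have "L * P = P * L" by simp
      ultimately show ?thesis by linarith
    qed
    moreover have "\<exists>t. optimal_exit_computer D md Z \<mu> t"
      using optimal_exit_exists[OF Z root usable_mark[OF y], of \<mu> D] g
      by (auto simp: optimal_exit_computer_def)
    ultimately have "runs_within D md Z \<mu> (4 * (P * L))" by (simp add: runs_within_def)
    then show ?thesis by (simp add: P_def L_def h_def s_def algebra_simps)
  qed
  moreover have "0 \<le> 4 * (7 + K)" by (simp add: K_def)
  ultimately show thesis using that by blast
qed

text \<open>The assumption excludes machines with one state and no inputs, for which the bound vanishes.\<close>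

lemma layer_bound_absorbs:
  assumes "2 \<le> max_states Z + card (Sigma_of Z)"
  shows "layer_bound Z + real (max_states Z + card (Sigma_of Z)) + 1 \<le> 3 * layer_bound Z"
proof -
  define h where "h = real (max_states Z + card (Sigma_of Z))"
  have h: "2 \<le> h" using assms by (simp add: h_def)
  \<comment> \<open>The logarithm is at least 1 since \<open>2 \<le> h\<close>. So both
    \<open>h\<close> and 1 are bounded by \<open>layer_bound Z\<close>, which gives the factor
    3.\<close>
  then have "h \<le> h * log 2 h" by simp
  moreover have "h * log 2 h \<le> layer_bound Z"
    by (simp add: layer_bound_def Let_def h_def)
  ultimately show ?thesis unfolding h_def[symmetric] using h by linarith
qed

text \<open>One \<open>B * B\<close> comes from the product of states and inputs, the other four
  from \<open>h * log 2 h \<le> h * h\<close> with \<open>h \<le> 2 * B\<close>.\<close>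

lemma layer_bound_bounded:
  assumes "max_states Z \<le> B" "card (Sigma_of Z) \<le> B" "1 \<le> max_states Z"
  shows "layer_bound Z \<le> real (5 * B * B)"
proof -
  define h where "h = real (max_states Z + card (Sigma_of Z))"
  have h: "1 \<le> h" "h \<le> 2 * real B" using assms by (auto simp: h_def)
  have "log 2 h \<le> h"
    using log2_of_power_less[of "max_states Z + card (Sigma_of Z)" "max_states Z + card (Sigma_of Z)"]
      assms(3) by (simp add: h_def)
  then have "h * log 2 h \<le> (2 * real B) * (2 * real B)"
    using h by (intro mult_mono) auto
  moreover have "real (max_states Z) * real (card (Sigma_of Z)) \<le> real B * real B"
    using assms by (intro mult_mono) auto
  ultimately show ?thesis by (simp add: layer_bound_def Let_def h_def)
qed

theorem proposition2:
  fixes D :: "(('q, 'x) aug_state, 'x, ennreal) mm \<Rightarrow> (('q, 'x) aug_state, 'x) sp_result \<times> nat"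
  assumes "dijkstra_fibonacci D"
  shows
    "(\<exists>C. \<forall>(md :: ('n, 'q, 'x) modification) Z \<mu>.
        yields md Z \<and> (\<forall>Y\<in>given_himms md. is_himm Y \<and> up_to_date \<mu> Y) \<and>
        2 \<le> max_states Z + card (Sigma_of Z) \<and> \<not> is_Composition md \<longrightarrow>
        runs_within D md Z \<mu> (C * (real (depth Z) * layer_bound Z))) \<and>
     (\<exists>C. \<forall>(md :: ('n, 'q, 'x) modification) Z \<mu>.
        yields md Z \<and> (\<forall>Y\<in>given_himms md. is_himm Y \<and> up_to_date \<mu> Y) \<and>
        2 \<le> max_states Z + card (Sigma_of Z) \<and> is_Composition md \<longrightarrow>
        runs_within D md Z \<mu> (C * layer_bound Z)) \<and>
     (\<forall>B. \<exists>C. \<forall>(md :: ('n, 'q, 'x) modification) Z \<mu>.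
        yields md Z \<and> (\<forall>Y\<in>given_himms md. is_himm Y \<and> up_to_date \<mu> Y) \<and>
        max_states Z \<le> B \<and> card (Sigma_of Z) \<le> B \<longrightarrow>
        runs_within D md Z \<mu> (C * real (depth Z)))"
proof -
  obtain K where K: "0 \<le> K"
    and run: "\<And>(md :: ('n, 'q, 'x) modification) Z \<mu>. \<lbrakk>yields md Z;
      \<forall>Y\<in>given_himms md. is_himm Y \<and> up_to_date \<mu> Y\<rbrakk> \<Longrightarrow>
      runs_within D md Z \<mu> (K * (real (card (nodes_to_mark md Z)) *
        (layer_bound Z + real (max_states Z + card (Sigma_of Z)) + 1)))"
    using optimal_exit_computer_runs_within[OF assms] by blast
  \<comment> \<open>\<open>p\<close> will be \<open>depth Z\<close> or 1, and \<open>b\<close> the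
    absorbed or the uniform bound for a layer.\<close>
  have general: "runs_within D md Z \<mu> (K * (real p * b))"
    if "yields md Z" "\<forall>Y\<in>given_himms md. is_himm Y \<and> up_to_date \<mu> Y"
      "card (nodes_to_mark md Z) \<le> p"
      "layer_bound Z + real (max_states Z + card (Sigma_of Z)) + 1 \<le> b" "0 \<le> b"
    for md :: "('n, 'q, 'x) modification" and Z \<mu> p b
  proof -
    have "real (card (nodes_to_mark md Z)) *
        (layer_bound Z + real (max_states Z + card (Sigma_of Z)) + 1) \<le> real p * b"
      using that(3-5) by (meson mult_left_mono mult_right_mono of_nat_0_le_iff of_nat_mono order_trans)
    then show ?thesis using runs_within_mono[OF run[OF that(1,2)]] K by (simp add: mult_left_mono)
  qed
  have absorbed: "runs_within D md Z \<mu> (3 * K * (real p * layer_bound Z))"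
    if "yields md Z" "\<forall>Y\<in>given_himms md. is_himm Y \<and> up_to_date \<mu> Y"
      "card (nodes_to_mark md Z) \<le> p" "2 \<le> max_states Z + card (Sigma_of Z)"
    for md :: "('n, 'q, 'x) modification" and Z \<mu> p
    using general[OF that(1-3) layer_bound_absorbs[OF that(4)]] layer_bound_absorbs[OF that(4)]
    by (simp add: algebra_simps)
  have nodes: "is_himm Z" "modified_node md \<in> nodes Z"
    if "yields md Z" "\<forall>Y\<in>given_himms md. is_himm Y \<and> up_to_date \<mu> Y"
    for md :: "('n, 'q, 'x) modification" and Z \<mu>
    using is_himm_yields modified_node_in_nodes that by blast+
  show ?thesis
  proof (rule conjI[OF exI[of _ "3 * K"] conjI[OF exI[of _ "3 * K"] allI]]; (intro allI impI)?)
    fix md :: "('n, 'q, 'x) modification" and Z and \<mu> :: "('n, 'q, 'x) memory"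
    assume a: "yields md Z \<and> (\<forall>Y\<in>given_himms md. is_himm Y \<and> up_to_date \<mu> Y) \<and>
      2 \<le> max_states Z + card (Sigma_of Z) \<and> \<not> is_Composition md"
    then show "runs_within D md Z \<mu> (3 * K * (real (depth Z) * layer_bound Z))"
      using absorbed card_nodes_to_mark(2) nodes by blast
  next
    fix md :: "('n, 'q, 'x) modification" and Z and \<mu> :: "('n, 'q, 'x) memory"
    assume a: "yields md Z \<and> (\<forall>Y\<in>given_himms md. is_himm Y \<and> up_to_date \<mu> Y) \<and>
      2 \<le> max_states Z + card (Sigma_of Z) \<and> is_Composition md"
    then have "card (nodes_to_mark md Z) = 1"
      using card_nodes_to_mark(3) nodes by blast
    then show "runs_within D md Z \<mu> (3 * K * layer_bound Z)"
      using absorbed[of md Z \<mu> 1] a by simp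
  next
    fix B
    \<comment> \<open>The uniform bound for a layer keeps the linear and constant summands, so
      machines with one state and no inputs are included. Compositions need no separate case because
      the depth is at least 1.\<close>
    define b where "b = real (5 * B * B) + real (B + B) + 1"
    have "runs_within D md Z \<mu> (K * b * real (depth Z))"
      if a: "yields md Z \<and> (\<forall>Y\<in>given_himms md. is_himm Y \<and> up_to_date \<mu> Y) \<and>
        max_states Z \<le> B \<and> card (Sigma_of Z) \<le> B"
      for md :: "('n, 'q, 'x) modification" and Z \<mu>
    proof -
      have Z: "is_himm Z" and m: "modified_node md \<in> nodes Z" using nodes a by blast+
      have "1 \<le> max_states Z"
        using card_states_pos[OF is_himmD(3)[OF Z m]] card_states_le_max_states[OF Z m] by simp
      then have "layer_bound Z + real (max_states Z + card (Sigma_of Z)) + 1 \<le> b"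
        using layer_bound_bounded[of Z B] a unfolding b_def by (intro add_mono of_nat_mono) auto
      then have "runs_within D md Z \<mu> (K * (real (depth Z) * b))"
        using general[OF _ _ card_nodes_to_mark(2)[OF Z m]] a by (simp add: b_def)
      then show ?thesis by (simp add: mult.assoc mult.left_commute mult.commute)
    qed
    then show "\<exists>C. \<forall>(md :: ('n, 'q, 'x) modification) Z \<mu>.
        yields md Z \<and> (\<forall>Y\<in>given_himms md. is_himm Y \<and> up_to_date \<mu> Y) \<and>
        max_states Z \<le> B \<and> card (Sigma_of Z) \<le> B \<longrightarrow>
        runs_within D md Z \<mu> (C * real (depth Z))"
      by blast
  qed
qed

end
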